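(* With the mesh $h>0$ fixed, $$\sqrt{d_N}\,\bigl(\widehat\theta^{(N)}-\theta\bigr)\sim\mathcal N(0,\alpha^{2})\quad\text{for every }N,\qquad\text{hence}\qquad \sqrt{d_N}\,\bigl(\widehat\theta^{(N)}-\theta\bigr)\xrightarrow{d}\mathcal N(0,\alpha^{2})\quad (N\to\infty),$$ and $$F_N:=\frac{1}{\alpha^{2}}\sqrt{\frac N2}\bigl(\widehat\alpha^{\,2}_N-\alpha^{2}\bigr)\xrightarrow{d}\mathcal N(0,1)\qquad (N\to\infty).$$ Moreover the two statistics $\sqrt{d_N}(\widehat\theta^{(N)}-\theta)$ and $F_N$ are independent for every $N$, so the convergence holds jointly with a diagonal limiting covariance.
   Context: Fix a mesh $h>0$, an integer $m\ge1$ and known Hurst parameters $H_1,\dots,H_m\in(1/2,1)$. Let $B^{H_1},\dots,B^{H_m}$ be independent fractional Brownian motions on one probability space, i.e. independent centred continuous Gaussian processes with $B^{H_r}(0)=0$ and $\mathbb E[B^{H_r}(t)B^{H_r}(s)]=\frac12(t^{2H_r}+s^{2H_r}-|t-s|^{2H_r})$ for $s,t\ge0$. For $\theta\in\mathbb R$ and $\alpha>0$ set $Z(t)=\theta t+\alpha\sum_{r=1}^m B^{H_r}(t)$ and $t_k=kh$. For $N\ge1$ let $\mathbf T_N=(t_1,\dots,t_N)^\top$, $\mathbf Z^{(N)}=(Z(t_1),\dots,Z(t_N))^\top$, and let $\Gamma_{H,N}$ be the $N\times N$ positive definite matrix with entries $\frac12\sum_{r=1}^m(t_i^{2H_r}+t_j^{2H_r}-|t_i-t_j|^{2H_r})$.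 Put $d_N=\mathbf T_N^\top\Gamma_{H,N}^{-1}\mathbf T_N$ and $$\widehat\theta^{(N)}=\frac{\mathbf T_N^\top\Gamma_{H,N}^{-1}\mathbf Z^{(N)}}{d_N},\qquad \widehat\alpha^{\,2}_N=\frac1N\left(\mathbf Z^{(N)\top}\Gamma_{H,N}^{-1}\mathbf Z^{(N)}-\frac{(\mathbf T_N^\top\Gamma_{H,N}^{-1}\mathbf Z^{(N)})^2}{d_N}\right).$$ $\xrightarrow{d}$ denotes convergence in distribution. *)

theory Defs
  imports
    "HOL-Probability.Probability"
    "Jordan_Normal_Form.Gauss_Jordan_Elimination"
begin

no_notation inner (infix "\<bullet>" 70)

section \<open>Gaussian laws and convergence in distribution\<close>

text \<open>The second argument is the variance; variance zero is the Dirac law. Degenerate laws have to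
  be admitted in the definition of a Gaussian process (for instance at time zero).\<close>

definition normal_law :: "real \<Rightarrow> real \<Rightarrow> real measure" where
  "normal_law \<mu> v =
    (if v = 0 then return borel \<mu> else density lborel (normal_density \<mu> (sqrt v)))"

definition gaussian_process :: "'a measure \<Rightarrow> real set \<Rightarrow> (real \<Rightarrow> 'a \<Rightarrow> real) \<Rightarrow> bool" where
  "gaussian_process M I X \<longleftrightarrow>
    (\<forall>t\<in>I. X t \<in> borel_measurable M) \<and>
    (\<forall>J c. finite J \<and> J \<subseteq> I \<longrightarrow>
      (\<exists>\<mu> v. 0 \<le> v \<and> distr M borel (\<lambda>\<omega>. \<Sum>t\<in>J. c t * X t \<omega>) = normal_law \<mu> v))"

text \<open>The centred normal law on the plane with covariance matrix \<open>((a, b), (b, c))\<close>,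
  meant for \<open>a > 0\<close> and \<open>a * c - b\<^sup>2 > 0\<close>.\<close>

definition bivariate_normal_density :: "real \<Rightarrow> real \<Rightarrow> real \<Rightarrow> real \<times> real \<Rightarrow> real" where
  "bivariate_normal_density a b c = (\<lambda>(x, y).
    exp (- (c * x\<^sup>2 - 2 * b * x * y + a * y\<^sup>2) / (2 * (a * c - b\<^sup>2))) /
      (2 * pi * sqrt (a * c - b\<^sup>2)))"

definition bivariate_normal_law :: "real \<Rightarrow> real \<Rightarrow> real \<Rightarrow> (real \<times> real) measure" where
  "bivariate_normal_law a b c = density lborel (bivariate_normal_density a b c)"

text \<open>The library's \<^const>\<open>weak_conv_m\<close> is restricted to laws on the real line.\<close>

definition weak_conv_law ::
    "(nat \<Rightarrow> 'b::topological_space measure) \<Rightarrow> 'b measure \<Rightarrow> bool" where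
  "weak_conv_law \<mu> \<nu> \<longleftrightarrow>
    (\<forall>f :: 'b \<Rightarrow> real. continuous_on UNIV f \<and> bounded (range f) \<longrightarrow>
      (\<lambda>n. integral\<^sup>L (\<mu> n) f) \<longlonglongrightarrow> integral\<^sup>L \<nu> f)"

section \<open>Fractional Brownian motion\<close>

definition fractional_brownian_motion :: "'a measure \<Rightarrow> real \<Rightarrow> (real \<Rightarrow> 'a \<Rightarrow> real) \<Rightarrow> bool" where
  "fractional_brownian_motion M H B \<longleftrightarrow>
    gaussian_process M {0..} B \<and>
    (\<forall>t\<ge>0. integral\<^sup>L M (B t) = 0) \<and>
    (AE \<omega> in M. continuous_on {0..} (\<lambda>t. B t \<omega>)) \<and>
    (AE \<omega> in M. B 0 \<omega> = 0) \<and>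
    (\<forall>s\<ge>0. \<forall>t\<ge>0. integral\<^sup>L M (\<lambda>\<omega>. B t \<omega> * B s \<omega>) =
      (t powr (2 * H) + s powr (2 * H) - \<bar>t - s\<bar> powr (2 * H)) / 2)"

text \<open>Independence of processes: of the induced random elements of the path space with its product
  sigma-algebra.\<close>

definition independent_processes ::
    "'a measure \<Rightarrow> 'i set \<Rightarrow> ('i \<Rightarrow> real \<Rightarrow> 'a \<Rightarrow> real) \<Rightarrow> bool" where
  "independent_processes M I B \<longleftrightarrow>
    prob_space.indep_vars M (\<lambda>_. \<Pi>\<^sub>M t\<in>{0..}. borel) (\<lambda>r \<omega>. \<lambda>t\<in>{0..}. B r t \<omega>) I"

definition mixed_fbm ::
    "real \<Rightarrow> real \<Rightarrow> nat \<Rightarrow> (nat \<Rightarrow> real \<Rightarrow> 'a \<Rightarrow> real) \<Rightarrow> real \<Rightarrow> 'a \<Rightarrow> real" where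
  "mixed_fbm \<theta> \<alpha> m B t \<omega> = \<theta> * t + \<alpha> * (\<Sum>r=1..m. B r t \<omega>)"

section \<open>The estimators\<close>

definition obs_time :: "real \<Rightarrow> nat \<Rightarrow> real" where
  "obs_time h k = real k * h"

text \<open>Vector and matrix indices start at 0, so the entry with index \<open>i\<close> belongs to the
  observation time with number \<open>i + 1\<close>.\<close>

definition obs_vec :: "real \<Rightarrow> nat \<Rightarrow> (real \<Rightarrow> real) \<Rightarrow> real vec" where
  "obs_vec h N z = vec N (\<lambda>i. z (obs_time h (i + 1)))"

definition time_vec :: "real \<Rightarrow> nat \<Rightarrow> real vec" where
  "time_vec h N = vec N (\<lambda>i. obs_time h (i + 1))"

definition fbm_cov_mat :: "real \<Rightarrow> nat \<Rightarrow> (nat \<Rightarrow> real) \<Rightarrow> nat \<Rightarrow> real mat" where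
  "fbm_cov_mat h m H N = mat N N (\<lambda>(i, j).
    let t = obs_time h (i + 1); s = obs_time h (j + 1) in
    1 / 2 * (\<Sum>r=1..m. t powr (2 * H r) + s powr (2 * H r) - \<bar>t - s\<bar> powr (2 * H r)))"

text \<open>The library inverse is an option. For \<open>h > 0\<close>, \<open>m \<ge> 1\<close> and Hurst parameters in
  \<open>(0, 1)\<close> the matrix is positive definite, so the case \<^const>\<open>None\<close> does not arise.\<close>

definition fbm_cov_inv :: "real \<Rightarrow> nat \<Rightarrow> (nat \<Rightarrow> real) \<Rightarrow> nat \<Rightarrow> real mat" where
  "fbm_cov_inv h m H N = the (mat_inverse (fbm_cov_mat h m H N))"

definition d_norm :: "real \<Rightarrow> nat \<Rightarrow> (nat \<Rightarrow> real) \<Rightarrow> nat \<Rightarrow> real" where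
  "d_norm h m H N = time_vec h N \<bullet> (fbm_cov_inv h m H N *\<^sub>v time_vec h N)"

definition theta_hat ::
    "real \<Rightarrow> nat \<Rightarrow> (nat \<Rightarrow> real) \<Rightarrow> nat \<Rightarrow> (real \<Rightarrow> real) \<Rightarrow> real" where
  "theta_hat h m H N z =
    (time_vec h N \<bullet> (fbm_cov_inv h m H N *\<^sub>v obs_vec h N z)) / d_norm h m H N"

definition alpha_sq_hat ::
    "real \<Rightarrow> nat \<Rightarrow> (nat \<Rightarrow> real) \<Rightarrow> nat \<Rightarrow> (real \<Rightarrow> real) \<Rightarrow> real" where
  "alpha_sq_hat h m H N z = 1 / real N *
    (obs_vec h N z \<bullet> (fbm_cov_inv h m H N *\<^sub>v obs_vec h N z)
      - (time_vec h N \<bullet> (fbm_cov_inv h m H N *\<^sub>v obs_vec h N z))\<^sup>2 / d_norm h m H N)"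

end

theory Submission
  imports
    Defs
    "HOL-Real_Asymp.Real_Asymp"
    "HOL-Computational_Algebra.Fundamental_Theorem_Algebra"
    "Jordan_Normal_Form.Determinant"
begin

text \<open>
  Let \<open>u\<^sub>0, \<dots>, u\<^sub>N\<^sub>-\<^sub>1\<close> be orthonormal for the inner product given by the covariance matrix, with \<open>u\<^sub>0\<close>
  proportional to the inverse of that matrix applied to the time vector. The coordinates
  \<open>Y\<^sub>i = u\<^sub>i \<bullet> W\<close> of the noise vector \<open>W\<close> are then independent standard normal. The drift only enters
  through the coordinate \<open>0\<close>, so that \<open>S = \<alpha> Y\<^sub>0\<close> and
  \<open>F = (Y\<^sub>1\<^sup>2 + \<dots> + Y\<^sub>N\<^sub>-\<^sub>1\<^sup>2 - N) / sqrt (2 N)\<close>. This gives the exact law of \<open>S\<close>, the independence, and,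
  by the central limit theorem, the limit law of \<open>F\<close>.

  The covariance matrix is invertible because a null vector would make the autocovariance of
  fractional Gaussian noise a two-sided solution of a linear recurrence; that sequence tends to zero
  at both ends, and such a solution vanishes identically.
\<close>

text \<open>Two obstacles shape the argument. Normality is assumed for each motion separately and
  independence for the family of motions, so the coordinates, which mix times and motions, are
  accessible only through the characteristic functions of their linear combinations. Independence is
  extracted from these one coordinate at a time, so that only uniqueness on the real line is used.

  Moreover the coordinates form a triangular array: the orthonormal system is chosen anew for each
  N, and nothing relates different rows. The central limit theorem speaks of one sequence; it is
  applied to an auxiliary sequence, and only its consequence for the powers of one characteristic
  function is carried over to the rows.

  The constants in F reflect the variance 2 of the square of a standard normal variable, as sqrt (N
  / 2) / N = 1 / sqrt (2 N). One of the N squares is missing because coordinate 0 is spent on the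
  drift; this leaves a deterministic shift - 1 / sqrt (2 N), which tends to 0.\<close>

no_notation vec_nth (infixl "$" 90)

section \<open>Two-sided linear recurrences\<close>

text \<open>This is p(E) f for the shift operator E. Complex scalars make p split into linear
  factors.\<close>

definition shift_poly :: "complex poly \<Rightarrow> (int \<Rightarrow> complex) \<Rightarrow> int \<Rightarrow> complex" where
  "shift_poly p f k = (\<Sum>i\<le>degree p. coeff p i * f (k + int i))"

lemma shift_poly_altdef:
  assumes "degree p \<le> n"
  shows "shift_poly p f k = (\<Sum>i\<le>n. coeff p i * f (k + int i))"
  unfolding shift_poly_def
  by (rule sum.mono_neutral_left) (use assms in \<open>auto simp: coeff_eq_0\<close>)

text \<open>Products of polynomials act as composites of operators: here E - z is applied after
  q(E).\<close>

lemma shift_poly_linear_factor: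
  "shift_poly ([:- z, 1:] * q) f k = shift_poly q f (k + 1) - z * shift_poly q f k"
proof -
  define n where "n = degree q"
  have "degree ([:- z, 1:] * q) \<le> Suc n"
    using degree_mult_le[of "[:- z, 1:]" q] by (simp add: n_def)
  then have "shift_poly ([:- z, 1:] * q) f k = (\<Sum>i\<le>Suc n. coeff ([:- z, 1:] * q) i * f (k + int i))"
    by (rule shift_poly_altdef)
  also have "\<dots> = (\<Sum>i\<le>Suc n. coeff (pCons 0 q) i * f (k + int i)) - z * (\<Sum>i\<le>Suc n. coeff q i * f (k + int i))"
    by (simp add: algebra_simps sum_subtractf sum_distrib_left del: sum.atMost_Suc)
  also have "(\<Sum>i\<le>Suc n. coeff q i * f (k + int i)) = shift_poly q f k"
    by (rule shift_poly_altdef[symmetric]) (simp add: n_def)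
  also have "(\<Sum>i\<le>Suc n. coeff (pCons 0 q) i * f (k + int i)) = shift_poly q f (k + 1)"
    by (subst sum.atMost_Suc_shift) (simp add: shift_poly_def n_def algebra_simps)
  finally show ?thesis .
qed

lemma shift_poly_tendsto_0:
  assumes "\<And>i::nat. ((\<lambda>n. f (g n + int i)) \<longlongrightarrow> 0) F"
  shows "((\<lambda>n. shift_poly p f (g n)) \<longlongrightarrow> 0) F"
  unfolding shift_poly_def by (intro tendsto_null_sum tendsto_mult_right_zero assms)

text \<open>For |z| <= 1 the modulus does not decrease towards the left, for |z| > 1 it does not
  decrease towards the right. In either case |g k| is bounded by a null sequence; decay at both ends
  is what excludes every z.\<close>

lemma geometric_two_sided_null:
  fixes g :: "int \<Rightarrow> complex"
  assumes rec: "\<And>k. g (k + 1) = z * g k"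
    and p: "(\<lambda>n. g (int n)) \<longlonglongrightarrow> 0" and m: "(\<lambda>n. g (- int n)) \<longlonglongrightarrow> 0"
  shows "g k = 0"
proof -
  have step: "g (k + int n) = z ^ n * g k" for n k
  proof (induction n)
    case (Suc n)
    have "g (k + int (Suc n)) = z * g (k + int n)"
      using rec[of "k + int n"] by (simp add: algebra_simps)
    with Suc show ?case by simp
  qed simp
  have "g k = 0" for k
  proof (cases "norm z \<le> 1")
    case True
    have "norm (g k) \<le> norm (g (k - int n))" for n
      using step[of "k - int n" n] True
      by (simp add: norm_mult norm_power mult_left_le_one_le power_le_one)
    moreover have "(\<lambda>n. g (k - int n)) \<longlonglongrightarrow> 0"
    proof (rule LIMSEQ_offset[where k = "nat \<bar>k\<bar>"])
      \<comment> \<open>After an offset by |k| the argument k - n becomes the negative of the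
        natural number n + (|k| - k).\<close>
      have "(\<lambda>n. g (- int (n + nat (\<bar>k\<bar> - k)))) \<longlonglongrightarrow> 0"
        using m by (rule LIMSEQ_ignore_initial_segment)
      then show "(\<lambda>n. g (k - int (n + nat \<bar>k\<bar>))) \<longlonglongrightarrow> 0"
        by (rule filterlim_cong[THEN iffD1, rotated -1]) (auto intro!: always_eventually arg_cong[where f=g])
    qed
    ultimately have "norm (g k) \<le> 0"
      by (intro tendsto_lowerbound[OF tendsto_norm_zero]) auto
    then show ?thesis by simp
  next
    case False
    have "norm (g k) \<le> norm (g (k + int n))" for n
      using step[of k n] False
      by (simp add: norm_mult norm_power mult_le_cancel_right1 one_le_power)
    moreover have "(\<lambda>n. g (k + int n)) \<longlonglongrightarrow> 0"
    proof (rule LIMSEQ_offset[where k = "nat \<bar>k\<bar>"])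
      have "(\<lambda>n. g (int (n + nat (\<bar>k\<bar> + k)))) \<longlonglongrightarrow> 0"
        using p by (rule LIMSEQ_ignore_initial_segment)
      then show "(\<lambda>n. g (k + int (n + nat \<bar>k\<bar>))) \<longlonglongrightarrow> 0"
        by (rule filterlim_cong[THEN iffD1, rotated -1]) (auto intro!: always_eventually arg_cong[where f=g])
    qed
    ultimately have "norm (g k) \<le> 0"
      by (intro tendsto_lowerbound[OF tendsto_norm_zero]) auto
    then show ?thesis by simp
  qed
  then show ?thesis .
qed

text \<open>One root is removed at a time: if p = (X - z) q, then g = q(E) f satisfies g (k + 1) = z
  g k and inherits the decay at both ends, so g = 0 and q already annihilates f. At the end a
  nonzero constant remains.\<close>

lemma two_sided_recurrence_null:
  fixes f :: "int \<Rightarrow> complex"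
  assumes "p \<noteq> 0"
    and "\<And>k. shift_poly p f k = 0"
    and f: "(\<lambda>n. f (int n)) \<longlonglongrightarrow> 0" "(\<lambda>n. f (- int n)) \<longlonglongrightarrow> 0"
  shows "f k = 0"
  using assms(1,2)
proof (induction "degree p" arbitrary: p)
  case 0
  then obtain c where c: "p = [:c:]" "c \<noteq> 0"
    by (metis degree_eq_zeroE pCons_0_0)
  with 0(3)[of k] show ?case by (simp add: shift_poly_def)
next
  case (Suc n)
  then have "\<not> constant (poly p)"
    by (simp add: constant_degree)
  then obtain z where "poly p z = 0"
    using fundamental_theorem_of_algebra by blast
  then obtain q where q: "p = [:- z, 1:] * q"
    by (metis dvdE poly_eq_0_iff_dvd)
  have "q \<noteq> 0"
    using q Suc.prems(1) by auto
  then have "degree p = 1 + degree q"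
    unfolding q by (subst degree_mult_eq) auto
  with Suc.hyps(2) have "degree q = n"
    by simp
  define g where "g = shift_poly q f"
  have fp: "(\<lambda>n. f (int n + int i)) \<longlonglongrightarrow> 0" for i
    using LIMSEQ_ignore_initial_segment[OF f(1), of i] by simp
  have fm: "(\<lambda>n. f (- int n + int i)) \<longlonglongrightarrow> 0" for i
  proof (rule LIMSEQ_offset[where k = i])
    show "(\<lambda>n. f (- int (n + i) + int i)) \<longlonglongrightarrow> 0" using f(2) by simp
  qed
  have "g k = 0" for k
  proof (rule geometric_two_sided_null[where z = z])
    show "g (k + 1) = z * g k" for k
      using Suc.prems(2)[of k] unfolding q shift_poly_linear_factor by (simp add: g_def)
  qed (use fp fm in \<open>auto simp: g_def intro!: shift_poly_tendsto_0\<close>)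
  with Suc.hyps(1)[of q] \<open>q \<noteq> 0\<close> \<open>degree q = n\<close> show ?case
    by (simp add: g_def)
qed

section \<open>Autocovariance of fractional Gaussian noise\<close>

text \<open>The covariance at lag k of the increments over unit intervals, that is, half the second
  difference of |k|^(2H). Lags are integers because the recurrence is two-sided.\<close>

definition fgn_cov :: "real \<Rightarrow> int \<Rightarrow> real" where
  "fgn_cov H k = (\<bar>real_of_int k + 1\<bar> powr (2 * H) + \<bar>real_of_int k - 1\<bar> powr (2 * H)
     - 2 * \<bar>real_of_int k\<bar> powr (2 * H)) / 2"

lemma fgn_cov_uminus: "fgn_cov H (- k) = fgn_cov H k"
proof -
  have "\<bar>- real_of_int k + 1\<bar> = \<bar>real_of_int k - 1\<bar>" "\<bar>- real_of_int k - 1\<bar> = \<bar>real_of_int k + 1\<bar>"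
    by auto
  then show ?thesis by (simp add: fgn_cov_def)
qed

lemma fgn_cov_0: "fgn_cov H 0 = 1"
  by (simp add: fgn_cov_def)

text \<open>The second difference of x^(2H) behaves like 2H(2H - 1) n^(2H - 2). The factor n^2
  compensates the bracket, whose first-order terms cancel, and the remaining power n^(2H - 2) tends
  to 0 because H < 1.\<close>

lemma fgn_cov_tendsto_0:
  assumes "H < 1"
  shows "(\<lambda>n. fgn_cov H (int n)) \<longlonglongrightarrow> 0"
proof -
  have "(\<lambda>n::nat. (real n)\<^sup>2 * ((1 + 1 / real n) powr (2 * H) + (1 - 1 / real n) powr (2 * H) - 2)) \<longlonglongrightarrow> 2 * H * (2 * H - 1)"
    using assms by real_asymp
  moreover have "(\<lambda>n::nat. real n powr (2 * H - 2) / 2) \<longlonglongrightarrow> 0"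
    using assms by real_asymp
  ultimately have "(\<lambda>n::nat. real n powr (2 * H - 2) / 2 *
      ((real n)\<^sup>2 * ((1 + 1 / real n) powr (2 * H) + (1 - 1 / real n) powr (2 * H) - 2))) \<longlonglongrightarrow> 0"
    by (auto dest: tendsto_mult)
  moreover have eq: "real n powr (2 * H - 2) / 2 *
      ((real n)\<^sup>2 * ((1 + 1 / real n) powr (2 * H) + (1 - 1 / real n) powr (2 * H) - 2)) = fgn_cov H (int n)"
    if "n \<ge> 1" for n :: nat
  proof -
    have "real n powr (2 * H) * (1 + 1 / real n) powr (2 * H) = (real n + 1) powr (2 * H)"
      "real n powr (2 * H) * (1 - 1 / real n) powr (2 * H) = (real n - 1) powr (2 * H)"
      using that by (simp_all add: powr_mult[symmetric] distrib_left right_diff_distrib)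
    moreover have "real n powr (2 * H - 2) * (real n)\<^sup>2 = real n powr (2 * H)"
      using that by (simp add: powr_diff powr_numeral)
    moreover have "P / 2 * (N * (x + y - 2)) = (P * N * x + P * N * y - 2 * (P * N)) / 2" for P N x y :: real
      by (simp add: field_simps)
    ultimately show ?thesis
      using that by (simp add: fgn_cov_def)
  qed
  ultimately show ?thesis
    by (elim Lim_transform_eventually)
       (use eq in \<open>auto intro!: eventually_mono[OF eventually_ge_at_top[of 1]]\<close>)
qed

section \<open>Gaussian laws and linear combinations of fractional Brownian motion\<close>

lemma normal_density_scale_std:
  assumes "0 < s"
  shows "density lborel (normal_density 0 s) = distr std_normal_distribution borel (\<lambda>x. s * x)"
proof -
  interpret prob_space std_normal_distribution
    by (rule prob_space_normal_density) simp
  have "distributed std_normal_distribution lborel (\<lambda>x. x) std_normal_density"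
    by (auto simp: distributed_def distr_id2)
  from normal_density_affine[OF this, of s 0] assms
  have "distributed std_normal_distribution lborel (\<lambda>x. s * x) (normal_density 0 s)"
    by simp
  then have "distr std_normal_distribution lborel (\<lambda>x. s * x) = density lborel (normal_density 0 s)"
    by (rule distributed_distr_eq_density)
  moreover have "distr std_normal_distribution lborel (\<lambda>x. s * x) = distr std_normal_distribution borel (\<lambda>x. s * x)"
    by (rule distr_cong) auto
  ultimately show ?thesis by (rule trans[OF sym])
qed

text \<open>The Dirac law is the image under the zero map, so both branches of
  \<open>normal_law\<close> share one representation and hence one formula for the characteristic
  function.\<close>

lemma normal_law_0_eq_distr:
  assumes "0 \<le> v"
  shows "normal_law 0 v = distr std_normal_distribution borel (\<lambda>x. sqrt v * x)"
proof (cases "v = 0")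
  case True
  interpret prob_space std_normal_distribution
    by (rule prob_space_normal_density) simp
  have "distr std_normal_distribution borel (\<lambda>x. 0 :: real) = return borel 0"
    by (rule distr_const) simp
  with True show ?thesis by (simp add: normal_law_def)
next
  case False
  with assms have "normal_law 0 v = density lborel (normal_density 0 (sqrt v))" and "0 < sqrt v"
    by (simp_all add: normal_law_def)
  from this(1) normal_density_scale_std[OF this(2)] show ?thesis by (rule trans)
qed

lemma char_normal_law_0:
  assumes "0 \<le> v"
  shows "char (normal_law 0 v) t = exp (- (v * t\<^sup>2) / 2)"
proof -
  have "char (normal_law 0 v) t = char std_normal_distribution (t * sqrt v)"
    by (simp add: normal_law_0_eq_distr[OF assms] char_def integral_distr mult_ac)
  also have "\<dots> = exp (- (v * t\<^sup>2) / 2)"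
    using assms by (simp add: char_std_normal_distribution power_mult_distrib mult_ac)
  finally show ?thesis .
qed

lemma normal_law_moments:
  assumes "0 \<le> v"
  shows integrable_normal_law_square: "integrable (normal_law \<mu> v) (\<lambda>x. x\<^sup>2)"
    and integrable_normal_law: "integrable (normal_law \<mu> v) (\<lambda>x. x)"
    and integral_normal_law: "(\<integral>x. x \<partial>normal_law \<mu> v) = \<mu>"
    and integral_normal_law_square: "(\<integral>x. x\<^sup>2 \<partial>normal_law 0 v) = v"
proof -
  have "integrable (normal_law \<mu> v) (\<lambda>x. x\<^sup>2) \<and> integrable (normal_law \<mu> v) (\<lambda>x. x)
      \<and> (\<integral>x. x \<partial>normal_law \<mu> v) = \<mu> \<and> (\<integral>x. x\<^sup>2 \<partial>normal_law 0 v) = v"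
  proof (cases "v = 0")
    case True
    interpret prob_space "return borel \<mu>"
      by (rule prob_space_return) simp
    have ae: "AE x in return borel \<mu>. x = \<mu>"
      by (subst AE_return) auto
    have "integrable (return borel \<mu>) (\<lambda>x. x\<^sup>2)"
      by (rule integrable_const_bound[of _ "\<mu>\<^sup>2"]) (use ae in auto)
    moreover have "integrable (return borel \<mu>) (\<lambda>x. x)"
      by (rule integrable_const_bound[of _ "\<bar>\<mu>\<bar>"]) (use ae in auto)
    moreover have "(\<integral>x. x \<partial>return borel \<mu>) = \<mu>" "(\<integral>x. x\<^sup>2 \<partial>return borel (0 :: real)) = 0"
      by (subst integral_return; simp)+
    moreover have "normal_law \<mu> v = return borel \<mu>" "normal_law 0 v = return borel 0"
      using True by (simp_all add: normal_law_def)
    ultimately show ?thesis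
      using True by (simp only: simp_thms)
  next
    case False
    then have s: "0 < sqrt v" using assms by simp
    \<comment> \<open>The integrand regroups to the density times x^2, because x^2 = (x - \<mu>)^2 +
      2 \<mu> x - \<mu>^2.\<close>
    have "integrable lborel (\<lambda>x. normal_density \<mu> (sqrt v) x * (x - \<mu>)\<^sup>2 + 
       2 * \<mu> * (normal_density \<mu> (sqrt v) x * x) - \<mu>\<^sup>2 * normal_density \<mu> (sqrt v) x)"
      using s by (intro Bochner_Integration.integrable_add Bochner_Integration.integrable_diff 
        integrable_mult_right integrable_normal_moment integrable_normal_moment_nz_1 integrable_normal_density)
    then have "integrable lborel (\<lambda>x. normal_density \<mu> (sqrt v) x * x\<^sup>2)"
      by (rule Bochner_Integration.integrable_cong[THEN iffD1, rotated -1]) (auto simp: power2_eq_square algebra_simps)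
    then show ?thesis
      using False s integral_normal_moment_nz_1[OF s, of \<mu>] integral_normal_moment_even[OF s, of 0 1]
        integrable_normal_moment_nz_1[OF s, of \<mu>] assms
      by (simp add: normal_law_def integrable_density integral_density fact_numeral)
  qed
  then show "integrable (normal_law \<mu> v) (\<lambda>x. x\<^sup>2)" "integrable (normal_law \<mu> v) (\<lambda>x. x)"
      "(\<integral>x. x \<partial>normal_law \<mu> v) = \<mu>" "(\<integral>x. x\<^sup>2 \<partial>normal_law 0 v) = v"
    by blast+
qed

lemma integral_sum_mult_sum:
  fixes f :: "'i \<Rightarrow> 'a \<Rightarrow> real" and g :: "'j \<Rightarrow> 'a \<Rightarrow> real"
  assumes "\<And>i j. i \<in> I \<Longrightarrow> j \<in> J \<Longrightarrow> integrable M (\<lambda>\<omega>. f i \<omega> * g j \<omega>)"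
  shows "(\<integral>\<omega>. (\<Sum>i\<in>I. a i * f i \<omega>) * (\<Sum>j\<in>J. b j * g j \<omega>) \<partial>M)
      = (\<Sum>i\<in>I. \<Sum>j\<in>J. a i * b j * (\<integral>\<omega>. f i \<omega> * g j \<omega> \<partial>M))" (is ?eq)
    and "integrable M (\<lambda>\<omega>. (\<Sum>i\<in>I. a i * f i \<omega>) * (\<Sum>j\<in>J. b j * g j \<omega>))" (is ?int)
proof -
  have *: "(\<Sum>i\<in>I. a i * f i \<omega>) * (\<Sum>j\<in>J. b j * g j \<omega>)
      = (\<Sum>i\<in>I. \<Sum>j\<in>J. a i * b j * (f i \<omega> * g j \<omega>))" for \<omega>
    by (simp add: sum_product mult_ac)
  show ?int
    unfolding * using assms by (intro Bochner_Integration.integrable_sum integrable_mult_right)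
  show ?eq
    unfolding * using assms by (simp add: integral_sum integrable_sum)
qed

definition fbm_cov :: "real \<Rightarrow> real \<Rightarrow> real \<Rightarrow> real" where
  "fbm_cov H s t = (t powr (2 * H) + s powr (2 * H) - \<bar>t - s\<bar> powr (2 * H)) / 2"

text \<open>The moment formulas in the definition of the motion carry information only once
  integrability is known, since a non-integrable function has integral 0 by convention.
  Integrability comes from the normal law of the combination with the single time t and coefficient
  1.\<close>

lemma (in prob_space) gaussian_process_square_integrable:
  assumes "gaussian_process M T X" "t \<in> T"
  shows "X t \<in> borel_measurable M" "integrable M (\<lambda>\<omega>. (X t \<omega>)\<^sup>2)" "integrable M (X t)"
proof -
  show X: "X t \<in> borel_measurable M"
    using assms by (simp add: gaussian_process_def)
  have "finite {t} \<and> {t} \<subseteq> T" using assms by simp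
  then obtain \<mu> v where "0 \<le> v" "distr M borel (\<lambda>\<omega>. \<Sum>s\<in>{t}. 1 * X s \<omega>) = normal_law \<mu> v"
    using assms(1)[unfolded gaussian_process_def, THEN conjunct2, rule_format, of "{t}" "\<lambda>_. 1"] by blast
  then have v: "0 \<le> v" "distr M borel (X t) = normal_law \<mu> v"
    by simp_all
  have "integrable (distr M borel (X t)) (\<lambda>x. x\<^sup>2)" and "integrable (distr M borel (X t)) (\<lambda>x. x)"
    unfolding v(2) by (rule integrable_normal_law_square[OF v(1)], rule integrable_normal_law[OF v(1)])
  from integrable_distr[OF X this(1)] integrable_distr[OF X this(2)]
  show "integrable M (\<lambda>\<omega>. (X t \<omega>)\<^sup>2)" "integrable M (X t)" .
qed

lemma integrable_mult_of_squares:
  fixes f g :: "'a \<Rightarrow> real"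
  assumes [measurable]: "f \<in> borel_measurable M" "g \<in> borel_measurable M"
    and "integrable M (\<lambda>x. (f x)\<^sup>2)" "integrable M (\<lambda>x. (g x)\<^sup>2)"
  shows "integrable M (\<lambda>x. f x * g x)"
proof (rule Bochner_Integration.integrable_bound)
  show "integrable M (\<lambda>x. (f x)\<^sup>2 + (g x)\<^sup>2)" using assms by simp
  have "\<bar>a * b\<bar> \<le> a\<^sup>2 + b\<^sup>2" for a b :: real
    using sum_squares_bound[of "\<bar>a\<bar>" "\<bar>b\<bar>"] mult_nonneg_nonneg[of "\<bar>a\<bar>" "\<bar>b\<bar>"]
    unfolding abs_mult power2_abs by linarith
  then show "AE x in M. norm (f x * g x) \<le> norm ((f x)\<^sup>2 + (g x)\<^sup>2)"
    by simp
qed simp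

text \<open>Being Gaussian yields a normal law with unspecified parameters; these are then
  identified from the mean and the covariances of the motion. The times are distinct because the
  definition of a Gaussian process indexes the coefficients by the times themselves.\<close>

lemma (in prob_space) fbm_combination_law:
  fixes a :: "'i \<Rightarrow> real"
  assumes fbm: "fractional_brownian_motion M H B"
    and I: "finite I" "inj_on \<tau> I" "\<And>i. i \<in> I \<Longrightarrow> 0 \<le> \<tau> i"
  defines "v \<equiv> \<Sum>i\<in>I. \<Sum>j\<in>I. a i * a j * fbm_cov H (\<tau> i) (\<tau> j)"
  shows "0 \<le> v" "distr M borel (\<lambda>\<omega>. \<Sum>i\<in>I. a i * B (\<tau> i) \<omega>) = normal_law 0 v"
    "(\<integral>\<omega>. (\<Sum>i\<in>I. a i * B (\<tau> i) \<omega>)\<^sup>2 \<partial>M) = v"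
    "integrable M (\<lambda>\<omega>. (\<Sum>i\<in>I. a i * B (\<tau> i) \<omega>)\<^sup>2)"
proof -
  let ?X = "\<lambda>\<omega>. \<Sum>i\<in>I. a i * B (\<tau> i) \<omega>"
  have gp: "gaussian_process M {0..} B" and mean: "\<And>t. 0 \<le> t \<Longrightarrow> expectation (B t) = 0"
    and cov: "\<And>s t. 0 \<le> s \<Longrightarrow> 0 \<le> t \<Longrightarrow> (\<integral>\<omega>. B t \<omega> * B s \<omega> \<partial>M) = fbm_cov H s t"
    using fbm by (auto simp: fractional_brownian_motion_def fbm_cov_def)
  have sq: "B t \<in> borel_measurable M" "integrable M (\<lambda>\<omega>. (B t \<omega>)\<^sup>2)" "integrable M (B t)" if "0 \<le> t" for t
    using gaussian_process_square_integrable[OF gp, of t] that by auto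
  have [measurable]: "?X \<in> borel_measurable M"
    using sq I by (intro borel_measurable_sum borel_measurable_times) auto
  \<comment> \<open>The coefficients are moved from the indices to the times, as
    \<open>gaussian_process\<close> asks.\<close>
  define c where "c t = a (the_inv_into I \<tau> t)" for t
  have "?X = (\<lambda>\<omega>. \<Sum>t\<in>\<tau> ` I. c t * B t \<omega>)"
    using I by (auto simp: sum.reindex c_def the_inv_into_f_f intro!: sum.cong)
  moreover have "finite (\<tau> ` I) \<and> \<tau> ` I \<subseteq> {0..}" using I by auto
  ultimately obtain \<mu> w where w: "0 \<le> w" "distr M borel ?X = normal_law \<mu> w"
    using gp[unfolded gaussian_process_def, THEN conjunct2, rule_format, of "\<tau> ` I" c] by auto
  have "\<mu> = expectation ?X"
    using integral_normal_law[OF w(1), of \<mu>] unfolding w(2)[symmetric] by (subst (asm) integral_distr) auto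
  also have "\<dots> = 0"
    using I sq mean by simp
  finally have \<mu>: "\<mu> = 0" .
  note X2 = integral_sum_mult_sum[of I I M "\<lambda>i. B (\<tau> i)" "\<lambda>i. B (\<tau> i)" a a]
  have int: "integrable M (\<lambda>\<omega>. B (\<tau> i) \<omega> * B (\<tau> j) \<omega>)" if "i \<in> I" "j \<in> I" for i j
    using that I sq by (intro integrable_mult_of_squares) auto
  have "(\<integral>\<omega>. ?X \<omega> ^ 2 \<partial>M) = (\<Sum>i\<in>I. \<Sum>j\<in>I. a i * a j * (\<integral>\<omega>. B (\<tau> i) \<omega> * B (\<tau> j) \<omega> \<partial>M))"
    using X2(1)[OF int] by (simp add: power2_eq_square)
  also have "\<dots> = v"
    unfolding v_def using I by (subst (2) sum.swap) (auto simp: cov mult_ac intro!: sum.cong)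
  finally show X: "(\<integral>\<omega>. ?X \<omega> ^ 2 \<partial>M) = v" .
  show "integrable M (\<lambda>\<omega>. ?X \<omega> ^ 2)"
    using X2(2)[OF int] by (simp add: power2_eq_square)
  have "w = (\<integral>x. x\<^sup>2 \<partial>distr M borel ?X)"
    unfolding w(2) \<mu> by (rule integral_normal_law_square[OF w(1), symmetric])
  also have "\<dots> = v"
    using X by (subst integral_distr) auto
  finally show "0 \<le> v" "distr M borel ?X = normal_law 0 v"
    using w \<mu> by auto
qed

section \<open>Increments and non-degeneracy of fractional Brownian motion\<close>

text \<open>The left side is the covariance of two increments. The pure powers t^(2H) cancel, only
  powers of time differences survive, and the mesh factors out. That i - j alone enters is the
  stationarity of the increments.\<close>

lemma fbm_cov_increments:
  fixes i j :: nat
  assumes "0 < h"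
  defines "t \<equiv> \<lambda>k::nat. real k * h"
  shows "fbm_cov H (t (Suc i)) (t (Suc j)) - fbm_cov H (t (Suc i)) (t j)
      - fbm_cov H (t i) (t (Suc j)) + fbm_cov H (t i) (t j)
    = h powr (2 * H) * fgn_cov H (int i - int j)"
proof -
  have *: "\<bar>t k - t l\<bar> powr (2 * H) = h powr (2 * H) * \<bar>real k - real l\<bar> powr (2 * H)" for k l
  proof -
    have "\<bar>t k - t l\<bar> = h * \<bar>real k - real l\<bar>"
      using assms(1) by (simp add: t_def abs_mult left_diff_distrib[symmetric])
    then show ?thesis using assms(1) by (simp add: powr_mult)
  qed
  have "\<bar>real (Suc j) - real (Suc i)\<bar> = \<bar>real i - real j\<bar>" "\<bar>real j - real i\<bar> = \<bar>real i - real j\<bar>"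
    "\<bar>real j - real (Suc i)\<bar> = \<bar>real i - real j + 1\<bar>" "\<bar>real (Suc j) - real i\<bar> = \<bar>real i - real j - 1\<bar>"
    by auto
  then show ?thesis
    unfolding fbm_cov_def * by (simp add: fgn_cov_def field_simps)
qed

text \<open>Summation by parts: it serves to rewrite a combination of values of the motion as one of
  its increments.\<close>

lemma sum_triangle_swap:
  fixes f :: "nat \<Rightarrow> nat \<Rightarrow> 'a::comm_monoid_add"
  shows "(\<Sum>i<N. \<Sum>k\<le>i. f i k) = (\<Sum>k<N. \<Sum>i\<in>{k..<N}. f i k)"
proof (induction N)
  case (Suc N)
  have "(\<Sum>k<N. \<Sum>i\<in>{k..<Suc N}. f i k) = (\<Sum>k<N. (\<Sum>i\<in>{k..<N}. f i k) + f N k)"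
    by (intro sum.cong) auto
  with Suc show ?case
    by (simp add: sum.distrib lessThan_Suc_atMost[symmetric] add_ac)
qed simp

text \<open>A null vector yields a combination of increments with variance zero. By stationarity all
  its translates have variance zero, so each is almost surely zero and has covariance zero with
  every increment. These covariances are the recurrence, with coefficients \<open>b\<close>. Since
  the autocovariance at lag 0 is 1, the polynomial must be zero, hence \<open>b\<close> and then
  \<open>a\<close>.\<close>

lemma (in prob_space) fbm_cov_positive_definite:
  assumes fbm: "fractional_brownian_motion M H B" and H: "H < 1" and h: "0 < h"
    and null: "(\<Sum>i<N. \<Sum>j<N. a i * a j * fbm_cov H (real (Suc i) * h) (real (Suc j) * h)) = 0"
    and "i < N"
  shows "a i = 0"
proof -
  define t where "t k = real k * h" for k :: nat
  have t: "0 \<le> t k" for k using h by (simp add: t_def)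
  have inj: "inj_on (\<lambda>i. t (Suc i)) {..<N}" using h by (auto simp: inj_on_def t_def)
  define \<xi> where "\<xi> k \<omega> = B (t (Suc k)) \<omega> - B (t k) \<omega>" for k \<omega>
  \<comment> \<open>Tail sums of \<open>a\<close>: the coefficients of the increments after
    summation by parts.\<close>
  define b where "b k = (\<Sum>i\<in>{k..<N}. a i)" for k
  have gp: "gaussian_process M {0..} B" and B0: "AE \<omega> in M. B 0 \<omega> = 0"
    and cov: "\<And>s t. 0 \<le> s \<Longrightarrow> 0 \<le> t \<Longrightarrow> (\<integral>\<omega>. B t \<omega> * B s \<omega> \<partial>M) = fbm_cov H s t"
    using fbm by (auto simp: fractional_brownian_motion_def fbm_cov_def)
  have [measurable]: "B (t k) \<in> borel_measurable M" for k
    using gaussian_process_square_integrable[OF gp] t by auto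
  have int: "integrable M (\<lambda>\<omega>. B (t k) \<omega> * B (t l) \<omega>)" for k l
    using gaussian_process_square_integrable[OF gp] t by (intro integrable_mult_of_squares) auto
  have [measurable]: "\<xi> k \<in> borel_measurable M" for k
    unfolding \<xi>_def by measurable
  have \<xi>\<xi>: "\<xi> k \<omega> * \<xi> l \<omega> = B (t (Suc k)) \<omega> * B (t (Suc l)) \<omega> - B (t (Suc k)) \<omega> * B (t l) \<omega>
      - B (t k) \<omega> * B (t (Suc l)) \<omega> + B (t k) \<omega> * B (t l) \<omega>" for k l \<omega>
    by (simp add: \<xi>_def algebra_simps)
  have int\<xi>: "integrable M (\<lambda>\<omega>. \<xi> k \<omega> * \<xi> l \<omega>)" for k l
    unfolding \<xi>\<xi> using int by simp
  have cov\<xi>: "(\<integral>\<omega>. \<xi> k \<omega> * \<xi> l \<omega> \<partial>M) = h powr (2 * H) * fgn_cov H (int l - int k)" for k l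
    unfolding \<xi>\<xi> using int t
    by (simp add: cov fbm_cov_increments[OF h, folded t_def, symmetric])
  \<comment> \<open>The combination translated by s steps, to the right only since time starts at
    0.\<close>
  define X where "X s \<omega> = (\<Sum>k<N. b k * \<xi> (k + s) \<omega>)" for s \<omega>
  have [measurable]: "X s \<in> borel_measurable M" for s
    unfolding X_def by measurable
  have X_sq: "integrable M (\<lambda>\<omega>. X s \<omega> * X s \<omega>)" for s
    unfolding X_def using int\<xi> by (intro integral_sum_mult_sum(2))
  have X_var: "(\<integral>\<omega>. X s \<omega> * X s \<omega> \<partial>M) = (\<Sum>k<N. \<Sum>l<N. b k * b l * (h powr (2 * H) * fgn_cov H (int l - int k)))" for s
    unfolding X_def by (subst integral_sum_mult_sum(1)) (simp_all add: int\<xi> cov\<xi>)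
  \<comment> \<open>Only almost surely, because the increments telescope to the value minus
    \<open>B 0\<close>.\<close>
  have "AE \<omega> in M. X 0 \<omega> = (\<Sum>i<N. a i * B (t (Suc i)) \<omega>)"
    using B0
  proof eventually_elim
    case (elim \<omega>)
    have "(\<Sum>k\<le>i. \<xi> k \<omega>) = B (t (Suc i)) \<omega>" for i
      using elim by (induction i) (simp_all add: \<xi>_def t_def)
    then have "(\<Sum>i<N. a i * B (t (Suc i)) \<omega>) = (\<Sum>i<N. \<Sum>k\<le>i. a i * \<xi> k \<omega>)"
      by (simp add: sum_distrib_left[symmetric])
    also have "\<dots> = X 0 \<omega>"
      by (simp add: sum_triangle_swap X_def b_def sum_distrib_right)
    finally show ?case ..
  qed
  then have "(\<integral>\<omega>. X 0 \<omega> * X 0 \<omega> \<partial>M) = (\<integral>\<omega>. (\<Sum>i<N. a i * B (t (Suc i)) \<omega>)\<^sup>2 \<partial>M)"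
    by (intro integral_cong_AE) (auto simp: power2_eq_square)
  also have "\<dots> = 0"
    using fbm_combination_law(3)[OF fbm finite_lessThan inj t, of a] null[folded t_def] by (rule trans)
  \<comment> \<open>The double sum for the variance does not contain s, so its vanishing at s = 0
    gives it for every s.\<close>
  finally have "(\<integral>\<omega>. X s \<omega> * X s \<omega> \<partial>M) = 0" for s
    unfolding X_var .
  then have X_null: "AE \<omega> in M. X s \<omega> = 0" for s
    using integral_nonneg_eq_0_iff_AE[OF X_sq, of s] by simp
  have rec0: "(\<Sum>k<N. b k * fgn_cov H (int l - int (k + s))) = 0" for s l
  proof -
    \<comment> \<open>The increment is written as a sum over a singleton so that the bilinear
      expansion applies.\<close>
    have "(\<integral>\<omega>. X s \<omega> * (\<Sum>l\<in>{l}. 1 * \<xi> l \<omega>) \<partial>M) = (\<integral>\<omega>. 0 \<partial>M)"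
      using X_null[of s] by (intro integral_cong_AE) auto
    then have "(\<Sum>k<N. b k * (h powr (2 * H) * fgn_cov H (int l - int (k + s)))) = 0"
      unfolding X_def by (subst (asm) integral_sum_mult_sum(1)) (simp_all add: int\<xi> cov\<xi>)
    then have "h powr (2 * H) * (\<Sum>k<N. b k * fgn_cov H (int l - int (k + s))) = 0"
      by (simp add: sum_distrib_left mult_ac)
    then show ?thesis using h by simp
  qed
  have rec: "(\<Sum>k<N. b k * fgn_cov H (z + int k)) = 0" for z
  proof -
    \<comment> \<open>Time index and translation are natural numbers: the negative part of z serves
      as l and the positive part as s, so that l - s = - z. Evenness of the autocovariance turns the
      lag - z - k into z + k.\<close>
    have "(\<Sum>k<N. b k * fgn_cov H (int (nat (- z)) - int (k + nat z))) = 0"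
      by (rule rec0)
    moreover have "fgn_cov H (int (nat (- z)) - int (k + nat z)) = fgn_cov H (z + int k)" for k
      using fgn_cov_uminus[of H "z + int k"] by (cases "z \<ge> 0") (simp_all add: algebra_simps)
    ultimately show ?thesis by simp
  qed
  define p :: "complex poly" where "p = (\<Sum>k<N. monom (of_real (b k)) k)"
  have coeff_p: "coeff p k = (if k < N then of_real (b k) else 0)" for k
    by (simp add: p_def coeff_sum sum.delta)
  have "p = 0"
  proof (rule ccontr)
    assume "p \<noteq> 0"
    then have deg: "degree p < N"
      using coeff_p[of "degree p"] by (auto split: if_splits)
    have "(of_real (fgn_cov H 0) :: complex) = 0"
    proof (rule two_sided_recurrence_null[OF \<open>p \<noteq> 0\<close>])
      fix z
      have "shift_poly p (\<lambda>k. of_real (fgn_cov H k)) z = (\<Sum>k\<le>N - 1. coeff p k * of_real (fgn_cov H (z + int k)))"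
        using deg by (intro shift_poly_altdef) simp
      also have "\<dots> = of_real (\<Sum>k<N. b k * fgn_cov H (z + int k))"
        unfolding of_real_sum using deg by (intro sum.cong) (auto simp: coeff_p)
      finally show "shift_poly p (\<lambda>k. of_real (fgn_cov H k)) z = 0"
        by (simp add: rec)
    qed (use tendsto_of_real[OF fgn_cov_tendsto_0[OF H], where 'a = complex] in
          \<open>simp_all add: fgn_cov_uminus\<close>)
    then show False by (simp add: fgn_cov_0)
  qed
  then have "b k = 0" for k
  proof (cases "k < N")
    case True
    with \<open>p = 0\<close> coeff_p[of k] show ?thesis by simp
  qed (simp add: b_def)
  moreover have "b i = a i + b (Suc i)"
    using \<open>i < N\<close> by (simp add: b_def sum.atLeast_Suc_lessThan)
  ultimately show ?thesis by simp
qed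

section \<open>Joint characteristic functions\<close>

text \<open>Since \<open>g + K + 1 \<ge> 1\<close>, it is up to normalisation a probability density with respect to \<open>M\<close>;
  uniqueness is applied to the law of \<open>X\<close> under the reweighted measure.\<close>

lemma (in prob_space) char_weight_unique_real:
  fixes X g :: "'a \<Rightarrow> real" and \<kappa> K :: real
  assumes [measurable]: "X \<in> borel_measurable M" "g \<in> borel_measurable M"
    and g: "\<And>\<omega>. \<bar>g \<omega>\<bar> \<le> K"
    and char: "\<And>u. (\<integral>\<omega>. iexp (u * X \<omega>) * of_real (g \<omega>) \<partial>M) = of_real \<kappa> * char (distr M borel X) u"
    and [measurable]: "A \<in> sets borel"
  shows "(\<integral>\<omega>. indicator A (X \<omega>) * g \<omega> \<partial>M) = \<kappa> * measure (distr M borel X) A"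
proof -
  interpret X: real_distribution "distr M borel X"
    by (rule real_distribution_distr) simp
  define w where "w \<omega> = g \<omega> + (K + 1)" for \<omega>
  \<comment> \<open>The total mass of \<open>w\<close>: the hypothesis at u = 0 says that g has mean
    \<kappa>.\<close>
  define Z where "Z = \<kappa> + (K + 1)"
  have K: "0 \<le> K" using g[of undefined] by linarith
  have w_ge: "1 \<le> w \<omega>" for \<omega> using g[of \<omega>] by (simp add: w_def abs_le_iff)
  have [measurable]: "w \<in> borel_measurable M" unfolding w_def by simp
  have int_g: "integrable M g" by (rule integrable_const_bound[of _ K]) (auto simp: g)
  have int_gc: "integrable M (\<lambda>\<omega>. f \<omega> * of_real (g \<omega>))" if [measurable]: "f \<in> borel_measurable M" and "\<And>\<omega>. norm (f \<omega>) \<le> 1" for f :: "'a \<Rightarrow> complex"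
  proof (rule integrable_const_bound)
    show "AE \<omega> in M. norm (f \<omega> * of_real (g \<omega>)) \<le> 1 * K"
      unfolding norm_mult using g K that(2) by (intro AE_I2 mult_mono) auto
  qed simp
  have "of_real (\<integral>\<omega>. g \<omega> \<partial>M) = (of_real \<kappa> :: complex)"
    using char[of 0] X.char_zero by (simp add: int_g)
  then have g_int: "(\<integral>\<omega>. g \<omega> \<partial>M) = \<kappa>" by (simp only: of_real_eq_iff)
  have w_int: "(\<integral>\<omega>. w \<omega> \<partial>M) = Z" "integrable M w"
    using int_g unfolding w_def by (simp_all add: Z_def g_int prob_space)
  have Z: "1 \<le> Z"
    using integral_mono[of M "\<lambda>_. 1" w] w_int w_ge by (simp add: prob_space)
  define D where "D = density M (\<lambda>\<omega>. ennreal (w \<omega> / Z))"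
  have nonneg: "0 \<le> w \<omega> / Z" for \<omega> using w_ge[of \<omega>] Z by simp
  have [simp]: "sets D = sets M" "space D = space M" by (simp_all add: D_def)
  have [measurable]: "X \<in> borel_measurable D" by (simp add: D_def)
  interpret D: prob_space D
  proof
    have "emeasure D (space D) = (\<integral>\<^sup>+\<omega>. ennreal (w \<omega> / Z) \<partial>M)"
      by (simp add: D_def emeasure_density cong: nn_integral_cong)
    also have "\<dots> = ennreal (\<integral>\<omega>. w \<omega> / Z \<partial>M)"
      using w_int nonneg by (intro nn_integral_eq_integral) auto
    finally show "emeasure D (space D) = 1" using w_int Z by simp
  qed
  have "distr D borel X = distr M borel X"
  proof (rule Levy_uniqueness)
    show "real_distribution (distr D borel X)" by (rule D.real_distribution_distr) simp
    show "char (distr D borel X) = char (distr M borel X)"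
    proof
      fix u
      have "char (distr D borel X) u = (\<integral>\<omega>. (w \<omega> / Z) *\<^sub>R iexp (u * X \<omega>) \<partial>M)"
        unfolding char_def D_def using nonneg by (simp add: integral_distr integral_density)
      also have "\<dots> = (\<integral>\<omega>. (iexp (u * X \<omega>) * of_real (g \<omega>) + of_real (K + 1) * iexp (u * X \<omega>)) / of_real Z \<partial>M)"
        by (intro Bochner_Integration.integral_cong) (auto simp: w_def scaleR_conv_of_real algebra_simps)
      also have "\<dots> = ((\<integral>\<omega>. iexp (u * X \<omega>) * of_real (g \<omega>) \<partial>M) + of_real (K + 1) * (\<integral>\<omega>. iexp (u * X \<omega>) \<partial>M)) / of_real Z"
        using int_gc[of "\<lambda>\<omega>. iexp (u * X \<omega>)"] integrable_iexp[of "\<lambda>\<omega>. of_real (u * X \<omega>)"]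
        by (subst integral_divide_zero, subst Bochner_Integration.integral_add) auto
      also have "(\<integral>\<omega>. iexp (u * X \<omega>) \<partial>M) = char (distr M borel X) u"
        by (simp add: char_def integral_distr)
      also have "((\<integral>\<omega>. iexp (u * X \<omega>) * of_real (g \<omega>) \<partial>M) + of_real (K + 1) * char (distr M borel X) u) / of_real Z
          = of_real Z * char (distr M borel X) u / of_real Z"
        by (simp only: char) (simp add: Z_def algebra_simps)
      also have "\<dots> = char (distr M borel X) u" using Z by simp
      finally show "char (distr D borel X) u = char (distr M borel X) u" .
    qed
  qed unfold_locales
  then have "measure (distr M borel X) A = (\<integral>x. indicator A x \<partial>distr D borel X)"
    by simp
  also have "\<dots> = (\<integral>\<omega>. (indicator A (X \<omega>) * g \<omega> + (K + 1) * indicator A (X \<omega>)) / Z \<partial>M)"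
  proof -
    have "(\<integral>x. indicator A x \<partial>distr D borel X :: real) = (\<integral>\<omega>. (w \<omega> / Z) *\<^sub>R indicator A (X \<omega>) \<partial>M)"
      unfolding D_def using nonneg by (subst integral_distr, simp, simp, subst integral_density) auto
    also have "\<dots> = (\<integral>\<omega>. (indicator A (X \<omega>) * g \<omega> + (K + 1) * indicator A (X \<omega>)) / Z \<partial>M)"
      by (intro Bochner_Integration.integral_cong) (auto simp: w_def algebra_simps)
    finally show ?thesis .
  qed
  also have "\<dots> = ((\<integral>\<omega>. indicator A (X \<omega>) * g \<omega> \<partial>M) + (K + 1) * (\<integral>\<omega>. indicator A (X \<omega>) \<partial>M)) / Z"
  proof -
    have "integrable M (\<lambda>\<omega>. indicator A (X \<omega>) * g \<omega>)"
      using g K by (intro integrable_const_bound[of _ K]) (auto simp: indicator_def)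
    moreover have "integrable M (\<lambda>\<omega>. indicator A (X \<omega>) :: real)"
      by (intro integrable_const_bound[of _ 1]) (auto simp: indicator_def)
    ultimately show ?thesis
      by (subst integral_divide_zero, subst Bochner_Integration.integral_add) auto
  qed
  also have "(\<integral>\<omega>. indicator A (X \<omega>) \<partial>M :: real) = measure (distr M borel X) A"
  proof -
    have "(\<integral>\<omega>. indicator A (X \<omega>) \<partial>M :: real) = (\<integral>x. indicator A x \<partial>distr M borel X)"
      by (rule integral_distr[symmetric]) auto
    then show ?thesis by simp
  qed
  finally have "Z * measure (distr M borel X) A = (\<integral>\<omega>. indicator A (X \<omega>) * g \<omega> \<partial>M) + (K + 1) * measure (distr M borel X) A"
    using Z by (simp add: field_simps)
  then show ?thesis by (simp add: Z_def algebra_simps)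
qed

text \<open>Conjugating the hypothesis at - u gives the same identity for the conjugates of g and
  \<kappa>. Combining the two yields it for real and imaginary parts, which are real
  weights.\<close>

lemma (in prob_space) char_weight_unique:
  fixes X :: "'a \<Rightarrow> real" and g :: "'a \<Rightarrow> complex" and \<kappa> :: complex and K :: real
  assumes [measurable]: "X \<in> borel_measurable M" "g \<in> borel_measurable M"
    and g: "\<And>\<omega>. norm (g \<omega>) \<le> K"
    and char: "\<And>u. (\<integral>\<omega>. iexp (u * X \<omega>) * g \<omega> \<partial>M) = \<kappa> * char (distr M borel X) u"
    and [measurable]: "A \<in> sets borel"
  shows "(\<integral>\<omega>. indicator A (X \<omega>) * g \<omega> \<partial>M) = \<kappa> * measure (distr M borel X) A"
proof -
  have K: "0 \<le> K" using g[of undefined] norm_ge_zero order_trans by blast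
  have int: "integrable M (\<lambda>\<omega>. f \<omega> * g \<omega>)" "integrable M (\<lambda>\<omega>. f \<omega> * cnj (g \<omega>))"
    if [measurable]: "f \<in> borel_measurable M" and "\<And>\<omega>. norm (f \<omega>) \<le> 1" for f :: "'a \<Rightarrow> complex"
  proof -
    have [measurable]: "(\<lambda>\<omega>. cnj (g \<omega>)) \<in> borel_measurable M"
      by (rule borel_measurable_continuous_on[OF _ assms(2)]) (intro continuous_intros)
    have "norm (f \<omega> * g \<omega>) \<le> 1 * K" for \<omega>
      unfolding norm_mult using g K that(2) by (intro mult_mono) auto
    then show "integrable M (\<lambda>\<omega>. f \<omega> * g \<omega>)" "integrable M (\<lambda>\<omega>. f \<omega> * cnj (g \<omega>))"
      by (intro integrable_const_bound[of _ K]; simp add: norm_mult)+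
  qed
  have cnj_char: "cnj (char (distr M borel X) (- u)) = char (distr M borel X) u" for u
  proof -
    have "char (distr M borel X) u = (\<integral>x. cnj (iexp (- u * x)) \<partial>distr M borel X)"
      by (simp only: char_def exp_cnj) simp
    also have "\<dots> = cnj (char (distr M borel X) (- u))"
      unfolding char_def by (rule Bochner_Integration.integral_cnj)
    finally show ?thesis ..
  qed
  have char_cnj: "(\<integral>\<omega>. iexp (u * X \<omega>) * cnj (g \<omega>) \<partial>M) = cnj \<kappa> * char (distr M borel X) u" for u
  proof -
    have "(\<integral>\<omega>. iexp (u * X \<omega>) * cnj (g \<omega>) \<partial>M) = cnj (\<integral>\<omega>. iexp (- u * X \<omega>) * g \<omega> \<partial>M)"
    proof -
      have "(\<integral>\<omega>. iexp (u * X \<omega>) * cnj (g \<omega>) \<partial>M) = (\<integral>\<omega>. cnj (iexp (- u * X \<omega>) * g \<omega>) \<partial>M)"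
        by (simp only: complex_cnj_mult exp_cnj) simp
      then show ?thesis by (simp only: Bochner_Integration.integral_cnj)
    qed
    then show ?thesis by (simp only: char complex_cnj_mult cnj_char)
  qed
  have "(\<integral>\<omega>. iexp (u * X \<omega>) * of_real (Re (g \<omega>)) \<partial>M) = of_real (Re \<kappa>) * char (distr M borel X) u" for u
  proof -
    have "(\<integral>\<omega>. iexp (u * X \<omega>) * of_real (Re (g \<omega>)) \<partial>M) = (\<integral>\<omega>. (iexp (u * X \<omega>) * g \<omega> + iexp (u * X \<omega>) * cnj (g \<omega>)) / 2 \<partial>M)"
      by (intro Bochner_Integration.integral_cong) (auto simp: complex_eq_iff)
    also have "\<dots> = ((\<integral>\<omega>. iexp (u * X \<omega>) * g \<omega> \<partial>M) + (\<integral>\<omega>. iexp (u * X \<omega>) * cnj (g \<omega>) \<partial>M)) / 2"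
      by (subst integral_divide_zero, subst Bochner_Integration.integral_add) (auto intro!: int)
    also have "\<dots> = (\<kappa> * char (distr M borel X) u + cnj \<kappa> * char (distr M borel X) u) / 2"
      by (simp only: char char_cnj)
    also have "\<dots> = (\<kappa> + cnj \<kappa>) / 2 * char (distr M borel X) u"
      by (simp add: algebra_simps)
    also have "(\<kappa> + cnj \<kappa>) / 2 = of_real (Re \<kappa>)" by (simp add: complex_eq_iff)
    finally show ?thesis .
  qed
  then have R: "(\<integral>\<omega>. indicator A (X \<omega>) * Re (g \<omega>) \<partial>M) = Re \<kappa> * measure (distr M borel X) A"
    using g abs_Re_le_cmod order_trans by (intro char_weight_unique_real[of _ _ K]) (auto, blast)
  have "(\<integral>\<omega>. iexp (u * X \<omega>) * of_real (Im (g \<omega>)) \<partial>M) = of_real (Im \<kappa>) * char (distr M borel X) u" for u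
  proof -
    have "(\<integral>\<omega>. iexp (u * X \<omega>) * of_real (Im (g \<omega>)) \<partial>M) = (\<integral>\<omega>. (iexp (u * X \<omega>) * g \<omega> - iexp (u * X \<omega>) * cnj (g \<omega>)) / (2 * \<i>) \<partial>M)"
      by (intro Bochner_Integration.integral_cong) (auto simp: complex_eq_iff Re_divide Im_divide)
    also have "\<dots> = ((\<integral>\<omega>. iexp (u * X \<omega>) * g \<omega> \<partial>M) - (\<integral>\<omega>. iexp (u * X \<omega>) * cnj (g \<omega>) \<partial>M)) / (2 * \<i>)"
      by (subst integral_divide_zero, subst Bochner_Integration.integral_diff) (auto intro!: int)
    also have "\<dots> = (\<kappa> * char (distr M borel X) u - cnj \<kappa> * char (distr M borel X) u) / (2 * \<i>)"
      by (simp only: char char_cnj)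
    also have "\<dots> = (\<kappa> - cnj \<kappa>) / (2 * \<i>) * char (distr M borel X) u"
      by (simp add: algebra_simps diff_divide_distrib)
    also have "(\<kappa> - cnj \<kappa>) / (2 * \<i>) = of_real (Im \<kappa>)" by (simp add: complex_eq_iff Re_divide Im_divide)
    finally show ?thesis .
  qed
  then have I: "(\<integral>\<omega>. indicator A (X \<omega>) * Im (g \<omega>) \<partial>M) = Im \<kappa> * measure (distr M borel X) A"
    using g abs_Im_le_cmod order_trans by (intro char_weight_unique_real[of _ _ K]) (auto, blast)
  have "integrable M (\<lambda>\<omega>. indicator A (X \<omega>) * g \<omega>)"
    by (intro int) (auto simp: indicator_def)
  then have RI: "Re (\<integral>\<omega>. indicator A (X \<omega>) * g \<omega> \<partial>M) = (\<integral>\<omega>. Re (indicator A (X \<omega>) * g \<omega>) \<partial>M)"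
    "Im (\<integral>\<omega>. indicator A (X \<omega>) * g \<omega> \<partial>M) = (\<integral>\<omega>. Im (indicator A (X \<omega>) * g \<omega>) \<partial>M)"
    by (rule integral_Re[symmetric] integral_Im[symmetric])+
  have "Re (indicator A x * z) = indicator A x * Re z" "Im (indicator A x * z) = indicator A x * Im z"
    for x :: real and z :: complex
    by (simp_all add: indicator_def)
  then show ?thesis
    by (simp only: RI R I complex_eq_iff) simp
qed

text \<open>Kac's criterion. When one frequency u is left free, all other factors together form a
  bounded weight for the variable of that frequency, so uniqueness on the line works in the presence
  of the other variables.\<close>

lemma (in prob_space) joint_char_product_imp_indep:
  fixes X :: "nat \<Rightarrow> 'a \<Rightarrow> real"
  assumes [measurable]: "\<And>i. X i \<in> borel_measurable M"
    and law: "\<And>i. i < N \<Longrightarrow> distr M borel (X i) = \<mu> i"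
    and char: "\<And>c. (\<integral>\<omega>. iexp (\<Sum>i<N. c i * X i \<omega>) \<partial>M) = (\<Prod>i<N. char (\<mu> i) (c i))"
  shows "indep_vars (\<lambda>_. borel) X {..<N}"
proof (cases "N = 0")
  case False
  have real_dist: "real_distribution (distr M borel (X i))" for i
    by (rule real_distribution_distr) simp
  \<comment> \<open>The exponentials are replaced by indicators one coordinate at a time.\<close>
  have step: "(\<integral>\<omega>. (\<Prod>i<k. indicator (A i) (X i \<omega>)) * iexp (\<Sum>i\<in>{k..<N}. c i * X i \<omega>) \<partial>M)
      = of_real (\<Prod>i<k. measure (\<mu> i) (A i)) * (\<Prod>i\<in>{k..<N}. char (\<mu> i) (c i))"
    if "k \<le> N" and [measurable]: "\<And>i. A i \<in> sets borel" for k c and A :: "nat \<Rightarrow> real set"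
    using that(1)
  proof (induction k arbitrary: c)
    case 0
    then show ?case using char[of c] by (simp add: atLeast0LessThan)
  next
    case (Suc k)
    define g :: "'a \<Rightarrow> complex"
      where "g \<omega> = (\<Prod>i<k. indicator (A i) (X i \<omega>)) * iexp (\<Sum>i\<in>{Suc k..<N}. c i * X i \<omega>)" for \<omega>
    have [measurable]: "g \<in> borel_measurable M" unfolding g_def by measurable
    have "norm (g \<omega>) \<le> 1" for \<omega>
      by (auto simp: g_def norm_mult prod_norm[symmetric] indicator_def intro!: prod_le_1)
    moreover have "(\<integral>\<omega>. iexp (u * X k \<omega>) * g \<omega> \<partial>M)
        = of_real (\<Prod>i<k. measure (\<mu> i) (A i)) * (\<Prod>i\<in>{Suc k..<N}. char (\<mu> i) (c i)) * char (distr M borel (X k)) u" for u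
    proof -
      \<comment> \<open>The induction hypothesis is available for all frequencies, so that of
        coordinate k can be set to the free u.\<close>
      have "(\<Sum>i\<in>{k..<N}. (c(k := u)) i * X i \<omega>) = u * X k \<omega> + (\<Sum>i\<in>{Suc k..<N}. c i * X i \<omega>)" for \<omega>
        using Suc.prems by (subst sum.atLeast_Suc_lessThan) auto
      moreover have "(\<Prod>i\<in>{k..<N}. char (\<mu> i) ((c(k := u)) i)) = char (\<mu> k) u * (\<Prod>i\<in>{Suc k..<N}. char (\<mu> i) (c i))"
        using Suc.prems by (subst prod.atLeast_Suc_lessThan) auto
      ultimately show ?thesis
        using Suc.IH[of "c(k := u)"] Suc.prems
        by (simp add: g_def law exp_add distrib_left mult_ac)
    qed
    ultimately have "(\<integral>\<omega>. indicator (A k) (X k \<omega>) * g \<omega> \<partial>M)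
        = of_real (\<Prod>i<k. measure (\<mu> i) (A i)) * (\<Prod>i\<in>{Suc k..<N}. char (\<mu> i) (c i)) * measure (distr M borel (X k)) (A k)"
      by (intro char_weight_unique[where K = 1]) auto
    then show ?case
      using Suc.prems by (simp add: g_def law mult_ac)
  qed
  have "distr M (Pi\<^sub>M {..<N} (\<lambda>_. borel)) (\<lambda>\<omega>. \<lambda>i\<in>{..<N}. X i \<omega>) = Pi\<^sub>M {..<N} (\<lambda>i. distr M borel (X i))"
  proof -
    interpret P: product_sigma_finite "\<lambda>i. distr M borel (X i)"
      by (simp add: product_sigma_finite_def real_dist real_distribution.axioms(1)
          prob_space_imp_sigma_finite)
    show ?thesis
    proof (rule P.PiM_eqI)
      fix A assume A': "\<And>i. i \<in> {..<N} \<Longrightarrow> A i \<in> sets (distr M borel (X i))"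
      \<comment> \<open>Padding with the empty set makes every \<open>A' i\<close> a Borel set; the
        products only involve i < N.\<close>
      define A' where "A' i = (if i < N then A i else {})" for i
      have [measurable]: "A' i \<in> sets borel" for i using A' by (simp add: A'_def)
      have "emeasure (distr M (Pi\<^sub>M {..<N} (\<lambda>_. borel)) (\<lambda>\<omega>. \<lambda>i\<in>{..<N}. X i \<omega>)) (Pi\<^sub>E {..<N} A)
          = emeasure M {\<omega>\<in>space M. \<forall>i<N. X i \<omega> \<in> A' i}"
        using A' by (subst emeasure_distr)
          (auto intro!: arg_cong[where f = "emeasure M"] sets_PiM_I_finite simp: A'_def PiE_iff)
      also have "\<dots> = ennreal (measure M {\<omega>\<in>space M. \<forall>i<N. X i \<omega> \<in> A' i})"
        by (simp add: emeasure_eq_measure)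
      also have "measure M {\<omega>\<in>space M. \<forall>i<N. X i \<omega> \<in> A' i} = (\<Prod>i<N. measure (\<mu> i) (A' i))"
      proof -
        have [measurable]: "{\<omega>\<in>space M. \<forall>i<N. X i \<omega> \<in> A' i} \<in> sets M" by measurable
        have "of_real (measure M {\<omega>\<in>space M. \<forall>i<N. X i \<omega> \<in> A' i})
            = (\<integral>\<omega>. of_real (indicator {\<omega>\<in>space M. \<forall>i<N. X i \<omega> \<in> A' i} \<omega>) \<partial>M :: complex)"
          by (subst integral_complex_of_real) simp
        also have "\<dots> = (\<integral>\<omega>. (\<Prod>i<N. indicator (A' i) (X i \<omega>)) \<partial>M)"
          by (intro Bochner_Integration.integral_cong) (auto simp: indicator_def prod_zero_iff)
        also have "\<dots> = of_real (\<Prod>i<N. measure (\<mu> i) (A' i))"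
          using step[of N A' c] by simp
        finally show ?thesis by (simp only: of_real_eq_iff)
      qed
      also have "ennreal (\<Prod>i<N. measure (\<mu> i) (A' i)) = (\<Prod>i<N. emeasure (distr M borel (X i)) (A i))"
        by (auto simp: prod_ennreal[symmetric] A'_def law[symmetric] finite_measure.emeasure_eq_measure
            real_dist real_distribution.axioms(1) prob_space.finite_measure intro!: prod.cong)
      finally show "emeasure (distr M (Pi\<^sub>M {..<N} (\<lambda>_. borel)) (\<lambda>\<omega>. \<lambda>i\<in>{..<N}. X i \<omega>)) (Pi\<^sub>E {..<N} A)
          = (\<Prod>i\<in>{..<N}. emeasure (distr M borel (X i)) (A i))" .
    qed (auto intro!: sets_PiM_cong)
  qed
  then show ?thesis
    using False by (subst indep_vars_iff_distr_eq_PiM) auto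
qed (simp add: indep_vars_def indep_sets_def)

section \<open>Limit laws for standard normal arrays\<close>

text \<open>The centred chi-square law with one degree of freedom; its variance is 2.\<close>

definition chi_sq_dev :: "real measure" where
  "chi_sq_dev = distr std_normal_distribution borel (\<lambda>x. x\<^sup>2 - 1)"

lemma real_distribution_chi_sq_dev: "real_distribution chi_sq_dev"
proof -
  interpret real_distribution std_normal_distribution
    by (rule real_dist_normal_dist)
  show ?thesis
    unfolding chi_sq_dev_def by (rule real_distribution_distr) simp
qed

text \<open>The central limit theorem is applied on an infinite product of standard normal laws.
  There the characteristic function of a sum of n centred squares is an n-th power, and what
  survives is an analytic statement independent of the auxiliary space.\<close>

lemma char_chi_sq_dev_power_tendsto:
  "(\<lambda>n. char chi_sq_dev (t / sqrt (2 * real n)) ^ n) \<longlonglongrightarrow> exp (- (t\<^sup>2) / 2)"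
proof -
  define P where "P = Pi\<^sub>M (UNIV :: nat set) (\<lambda>_. std_normal_distribution)"
  have std: "prob_space std_normal_distribution"
    using real_dist_normal_dist by (simp add: real_distribution_def)
  interpret P: prob_space P
    unfolding P_def by (intro prob_space_PiM std)
  have sets_P: "sets P = sets (Pi\<^sub>M UNIV (\<lambda>_. borel))"
    unfolding P_def by (rule sets_PiM_cong) simp_all
  have coord: "(\<lambda>\<omega>. \<omega> i) \<in> borel_measurable P" for i
  proof -
    have "(\<lambda>\<omega>. \<omega> i) \<in> measurable P std_normal_distribution"
      unfolding P_def by simp
    then show ?thesis by simp
  qed
  have law: "distr P borel (\<lambda>\<omega>. \<omega> i) = std_normal_distribution" for i
  proof -
    have "distr P borel (\<lambda>\<omega>. \<omega> i) = distr P std_normal_distribution (\<lambda>\<omega>. \<omega> i)"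
      by (rule distr_cong) auto
    also have "\<dots> = std_normal_distribution"
      unfolding P_def by (rule distr_PiM_component) (simp_all add: std)
    finally show ?thesis .
  qed
  have "P.indep_vars (\<lambda>_. borel) (\<lambda>i \<omega>. \<omega> i) UNIV"
  proof (subst P.indep_vars_iff_distr_eq_PiM)
    have "distr P (Pi\<^sub>M UNIV (\<lambda>_. borel)) (\<lambda>x. x) = P"
      using sets_P by (rule distr_id2[OF sym])
    then show "distr P (Pi\<^sub>M UNIV (\<lambda>_. borel)) (\<lambda>x. \<lambda>i\<in>UNIV. x i) = Pi\<^sub>M UNIV (\<lambda>i. distr P borel (\<lambda>x. x i))"
      unfolding law by (simp add: P_def restrict_UNIV)
  qed (use coord in auto)
  then have indep: "P.indep_vars (\<lambda>_. borel) (\<lambda>i \<omega>. (\<omega> i)\<^sup>2 - 1) UNIV"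
    by (rule P.indep_vars_compose2[where Y = "\<lambda>_ x. x\<^sup>2 - 1"]) simp
  have dev: "distr P borel (\<lambda>\<omega>. (\<omega> i)\<^sup>2 - 1) = chi_sq_dev" for i
  proof -
    have "distr (distr P borel (\<lambda>\<omega>. \<omega> i)) borel (\<lambda>x. x\<^sup>2 - 1) = distr P borel ((\<lambda>x. x\<^sup>2 - 1) \<circ> (\<lambda>\<omega>. \<omega> i))"
      using coord by (intro distr_distr) auto
    then show ?thesis
      unfolding law chi_sq_dev_def by (simp add: comp_def)
  qed
  have int: "integrable std_normal_distribution (\<lambda>x. x ^ k)" for k
    by (rule integrable_std_normal_distribution_moment)
  have m2: "(\<integral>x. x ^ 2 \<partial>std_normal_distribution) = 1" and m4: "(\<integral>x. x ^ 4 \<partial>std_normal_distribution) = 3"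
    using std_normal_distribution_even_moments(1)[of 1] std_normal_distribution_even_moments(1)[of 2]
    by (simp_all add: fact_numeral)
  have std1: "(\<integral>x. 1 \<partial>std_normal_distribution) = (1 :: real)"
    using prob_space.prob_space[OF std] by simp
  have sq: "(x\<^sup>2 - 1)\<^sup>2 = x ^ 4 - 2 * x ^ 2 + (1 :: real)" for x
    by (simp add: power2_eq_square power4_eq_xxxx algebra_simps)
  have i1: "integrable std_normal_distribution (\<lambda>x. 1 :: real)"
    using int[of 0] by simp
  have E1: "P.expectation (\<lambda>\<omega>. (\<omega> i)\<^sup>2 - 1) = 0" for i
  proof -
    have "P.expectation (\<lambda>\<omega>. (\<omega> i)\<^sup>2 - 1) = (\<integral>x. x\<^sup>2 - 1 \<partial>distr P borel (\<lambda>\<omega>. \<omega> i))"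
      using coord by (intro integral_distr[symmetric]) auto
    also have "\<dots> = 0"
      unfolding law using int[of 2] i1 m2 std1 by (subst Bochner_Integration.integral_diff) auto
    finally show ?thesis .
  qed
  \<comment> \<open>The fourth moment 3 gives 3 - 2 + 1 = 2, written as a square because the central
    limit theorem is phrased with the standard deviation.\<close>
  have E2: "P.expectation (\<lambda>\<omega>. ((\<omega> i)\<^sup>2 - 1)\<^sup>2) = (sqrt 2)\<^sup>2" for i
  proof -
    have "P.expectation (\<lambda>\<omega>. ((\<omega> i)\<^sup>2 - 1)\<^sup>2) = (\<integral>x. (x\<^sup>2 - 1)\<^sup>2 \<partial>distr P borel (\<lambda>\<omega>. \<omega> i))"
      using coord by (intro integral_distr[symmetric]) auto
    also have "\<dots> = (\<integral>x. x ^ 4 \<partial>std_normal_distribution) - (\<integral>x. 2 * x ^ 2 \<partial>std_normal_distribution)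
        + (\<integral>x. 1 \<partial>std_normal_distribution)"
      unfolding law sq using int[of 4] int[of 2] i1
      by (subst Bochner_Integration.integral_add, simp, simp, subst Bochner_Integration.integral_diff) auto
    also have "\<dots> = 3 - 2 * 1 + 1"
      unfolding m4 std1 Bochner_Integration.integral_mult_right_zero m2 ..
    finally show ?thesis by simp
  qed
  have I2: "integrable P (\<lambda>\<omega>. ((\<omega> i)\<^sup>2 - 1)\<^sup>2)" for i
  proof -
    have "integrable (distr P borel (\<lambda>\<omega>. \<omega> i)) (\<lambda>x. (x\<^sup>2 - 1)\<^sup>2)"
      unfolding law sq using int[of 4] int[of 2] i1 by auto
    from integrable_distr[OF coord this] show ?thesis .
  qed
  have "weak_conv_m (\<lambda>n. distr P borel (\<lambda>\<omega>. (\<Sum>i<n. (\<omega> i)\<^sup>2 - 1) / sqrt (real n * (sqrt 2)\<^sup>2))) std_normal_distribution"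
    by (rule P.central_limit_theorem_zero_mean[OF indep E1 _ I2 _ dev]) (simp_all only: E1 E2 diff_0_right, simp)
  then have "(\<lambda>n. char (distr P borel (\<lambda>\<omega>. (\<Sum>i<n. (\<omega> i)\<^sup>2 - 1) / sqrt (real n * (sqrt 2)\<^sup>2))) t)
      \<longlonglongrightarrow> char std_normal_distribution t"
    by (intro levy_continuity1 real_dist_normal_dist P.real_distribution_distr)
       (auto intro!: borel_measurable_divide borel_measurable_sum borel_measurable_diff borel_measurable_power coord)
  moreover have "char (distr P borel (\<lambda>\<omega>. (\<Sum>i<n. (\<omega> i)\<^sup>2 - 1) / sqrt (real n * (sqrt 2)\<^sup>2))) t
      = char chi_sq_dev (t / sqrt (2 * real n)) ^ n" for n
  proof -
    have m: "(\<lambda>\<omega>. \<Sum>i<n. (\<omega> i)\<^sup>2 - 1) \<in> borel_measurable P"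
      using coord by (intro borel_measurable_sum borel_measurable_diff borel_measurable_power) auto
    have "char (distr P borel (\<lambda>\<omega>. (\<Sum>i<n. (\<omega> i)\<^sup>2 - 1) / sqrt (real n * (sqrt 2)\<^sup>2))) t
        = char (distr P borel (\<lambda>\<omega>. \<Sum>i<n. (\<omega> i)\<^sup>2 - 1)) (t / sqrt (2 * real n))"
      unfolding char_def using m by (simp add: integral_distr mult.commute)
    also have "\<dots> = char chi_sq_dev (t / sqrt (2 * real n)) ^ n"
      by (subst P.char_distr_sum[OF P.indep_vars_subset[OF indep]]) (simp_all add: dev)
    finally show ?thesis .
  qed
  ultimately show ?thesis
    by (simp add: char_std_normal_distribution)
qed

text \<open>The sequence is the characteristic function of F for sample size n. As
  \<open>char chi_sq_dev\<close> tends to 1 along t / sqrt (2 n), one factor can be divided out of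
  the n-th power without changing the limit, and the phase tends to 1.\<close>

lemma char_chi_sq_dev_power_pred_tendsto:
  "(\<lambda>n. char chi_sq_dev (t / sqrt (2 * real n)) ^ (n - 1) * iexp (- t / sqrt (2 * real n))) \<longlonglongrightarrow> exp (- (t\<^sup>2) / 2)"
proof -
  interpret real_distribution chi_sq_dev by (rule real_distribution_chi_sq_dev)
  have s: "(\<lambda>n. t / sqrt (2 * real n)) \<longlonglongrightarrow> 0"
    by real_asymp
  have psi: "(\<lambda>n. char chi_sq_dev (t / sqrt (2 * real n))) \<longlonglongrightarrow> 1"
    using isCont_tendsto_compose[OF isCont_char s] by (simp add: char_zero)
  have "(\<lambda>n. char chi_sq_dev (t / sqrt (2 * real n)) ^ n / char chi_sq_dev (t / sqrt (2 * real n)))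
      \<longlonglongrightarrow> complex_of_real (exp (- (t\<^sup>2) / 2)) / 1"
    by (intro tendsto_divide char_chi_sq_dev_power_tendsto psi) simp
  \<comment> \<open>The division is legitimate once the factor is nonzero, and n - 1 is the true
    predecessor once n >= 1.\<close>
  moreover have "eventually (\<lambda>n. char chi_sq_dev (t / sqrt (2 * real n)) ^ n / char chi_sq_dev (t / sqrt (2 * real n))
      = char chi_sq_dev (t / sqrt (2 * real n)) ^ (n - 1)) sequentially"
    using tendsto_imp_eventually_ne[OF psi, of 0, OF one_neq_zero] eventually_ge_at_top[of 1]
  proof eventually_elim
    case (elim n)
    then show ?case by (cases n) simp_all
  qed
  ultimately have "(\<lambda>n. char chi_sq_dev (t / sqrt (2 * real n)) ^ (n - 1)) \<longlonglongrightarrow> exp (- (t\<^sup>2) / 2)"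
    by (auto elim: Lim_transform_eventually)
  moreover have "(\<lambda>n. iexp (- t / sqrt (2 * real n))) \<longlonglongrightarrow> 1"
    using isCont_tendsto_compose[OF isCont_iexp tendsto_minus[OF s]] by simp
  ultimately show ?thesis by (auto dest: tendsto_mult)
qed

text \<open>The exact descriptions of S and F hold from N = 1 on, so limits are proved along
  \<open>Suc n\<close>.\<close>

lemma weak_conv_m_Suc: "weak_conv_m (\<lambda>n. \<mu> (Suc n)) \<nu> \<Longrightarrow> weak_conv_m \<mu> \<nu>"
  unfolding weak_conv_m_def weak_conv_def by (subst (asm) filterlim_sequentially_Suc) blast

section \<open>The joint limit law\<close>

lemma bivariate_normal_law_diagonal:
  assumes "0 < \<alpha>"
  shows "bivariate_normal_law (\<alpha>\<^sup>2) 0 1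
    = density lborel (normal_density 0 \<alpha>) \<Otimes>\<^sub>M std_normal_distribution"
proof -
  have "bivariate_normal_density (\<alpha>\<^sup>2) 0 1 (x, y) = normal_density 0 \<alpha> x * std_normal_density y" for x y
  proof -
    have "- (x\<^sup>2 + \<alpha>\<^sup>2 * y\<^sup>2) / (2 * \<alpha>\<^sup>2) = - x\<^sup>2 / (2 * \<alpha>\<^sup>2) + - y\<^sup>2 / 2"
      using assms by (simp add: field_simps)
    then have "exp (- (x\<^sup>2 + \<alpha>\<^sup>2 * y\<^sup>2) / (2 * \<alpha>\<^sup>2)) = exp (- x\<^sup>2 / (2 * \<alpha>\<^sup>2)) * exp (- y\<^sup>2 / 2)"
      by (simp only: exp_add)
    moreover have "2 * pi * sqrt (\<alpha>\<^sup>2) = sqrt (2 * pi * \<alpha>\<^sup>2) * sqrt (2 * pi)"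
    proof -
      have "sqrt (2 * pi * \<alpha>\<^sup>2) * sqrt (2 * pi) = sqrt (2 * pi) * sqrt (2 * pi) * sqrt (\<alpha>\<^sup>2)"
        by (subst (1) real_sqrt_mult[of "2 * pi"]) (simp only: mult_ac)
      then show ?thesis by (simp only: real_sqrt_mult_self) simp
    qed
    ultimately have "exp (- (x\<^sup>2 + \<alpha>\<^sup>2 * y\<^sup>2) / (2 * \<alpha>\<^sup>2)) / (2 * pi * sqrt (\<alpha>\<^sup>2))
        = normal_density 0 \<alpha> x * std_normal_density y"
      by (simp only:) (simp add: normal_density_def)
    moreover have "bivariate_normal_density (\<alpha>\<^sup>2) 0 1 (x, y)
        = exp (- (x\<^sup>2 + \<alpha>\<^sup>2 * y\<^sup>2) / (2 * \<alpha>\<^sup>2)) / (2 * pi * sqrt (\<alpha>\<^sup>2))"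
      by (simp add: bivariate_normal_density_def)
    ultimately show ?thesis by simp
  qed
  then have *: "ennreal (bivariate_normal_density (\<alpha>\<^sup>2) 0 1 z)
      = (case z of (x, y) \<Rightarrow> ennreal (normal_density 0 \<alpha> x) * ennreal (std_normal_density y))" for z
    by (cases z) (simp add: ennreal_mult)
  have "sigma_finite_measure std_normal_distribution"
    using real_dist_normal_dist
    by (simp add: real_distribution_def prob_space_imp_sigma_finite)
  then have "density lborel (normal_density 0 \<alpha>) \<Otimes>\<^sub>M std_normal_distribution
      = density (lborel \<Otimes>\<^sub>M lborel) (\<lambda>(x, y). ennreal (normal_density 0 \<alpha> x) * ennreal (std_normal_density y))"
    by (intro pair_measure_density sigma_finite_lborel) auto
  then show ?thesis
    unfolding bivariate_normal_law_def * by (simp add: lborel_prod)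
qed

text \<open>Integrating out the second coordinate leaves functions of x that converge pointwise by
  weak convergence and are bounded by K; dominated convergence under the fixed \<mu> finishes. A
  fixed first factor suffices because S has the same law for every N >= 1.\<close>

lemma weak_conv_law_pair_fixed:
  assumes \<mu>: "real_distribution \<mu>" and \<nu>n: "\<And>n. real_distribution (\<nu>n n)" and \<nu>: "real_distribution \<nu>"
    and conv: "weak_conv_m \<nu>n \<nu>"
  shows "weak_conv_law (\<lambda>n. \<mu> \<Otimes>\<^sub>M \<nu>n n) (\<mu> \<Otimes>\<^sub>M \<nu>)"
  unfolding weak_conv_law_def
proof (intro allI impI, elim conjE)
  fix f :: "real \<times> real \<Rightarrow> real"
  assume cont: "continuous_on UNIV f" and "bounded (range f)"
  then obtain K where K: "\<And>z. \<bar>f z\<bar> \<le> K"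
    by (auto simp: bounded_iff)
  have f [measurable]: "f \<in> borel_measurable borel"
    using cont by (rule borel_measurable_continuous_onI)
  have iterated: "(\<integral>z. f z \<partial>(\<mu> \<Otimes>\<^sub>M \<rho>)) = (\<integral>x. (\<integral>y. f (x, y) \<partial>\<rho>) \<partial>\<mu>)"
    and meas: "(\<lambda>x. \<integral>y. f (x, y) \<partial>\<rho>) \<in> borel_measurable \<mu>"
    if "real_distribution \<rho>" for \<rho>
  proof -
    interpret \<mu>: real_distribution \<mu> by (rule \<mu>)
    interpret \<rho>: real_distribution \<rho> by (rule that)
    interpret pair_prob_space \<mu> \<rho> ..
    have "sets (\<mu> \<Otimes>\<^sub>M \<rho>) = sets (borel :: (real \<times> real) measure)"
      by (subst borel_prod[symmetric]) (rule sets_pair_measure_cong, simp_all)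
    then have fp: "f \<in> borel_measurable (\<mu> \<Otimes>\<^sub>M \<rho>)"
      using f by (simp cong: measurable_cong_sets)
    then have "integrable (\<mu> \<Otimes>\<^sub>M \<rho>) f"
      using K by (intro P.integrable_const_bound[of _ K]) auto
    then show "(\<integral>z. f z \<partial>(\<mu> \<Otimes>\<^sub>M \<rho>)) = (\<integral>x. (\<integral>y. f (x, y) \<partial>\<rho>) \<partial>\<mu>)"
      by (rule integral_fst'[symmetric])
    show "(\<lambda>x. \<integral>y. f (x, y) \<partial>\<rho>) \<in> borel_measurable \<mu>"
      using fp by (intro \<rho>.borel_measurable_lebesgue_integral) simp
  qed
  interpret \<mu>: real_distribution \<mu> by (rule \<mu>)
  have "(\<lambda>n. \<integral>x. (\<integral>y. f (x, y) \<partial>\<nu>n n) \<partial>\<mu>) \<longlonglongrightarrow> (\<integral>x. (\<integral>y. f (x, y) \<partial>\<nu>) \<partial>\<mu>)"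
  proof (rule integral_dominated_convergence)
    show "integrable \<mu> (\<lambda>_. K)" by simp
    show "AE x in \<mu>. (\<lambda>n. \<integral>y. f (x, y) \<partial>\<nu>n n) \<longlonglongrightarrow> (\<integral>y. f (x, y) \<partial>\<nu>)"
    proof (rule AE_I2)
      fix x
      have "continuous_on UNIV (\<lambda>y. f (x, y))"
        by (rule continuous_on_compose2[OF cont]) (auto intro!: continuous_intros)
      then have "isCont (\<lambda>y. f (x, y)) y" for y
        by (simp add: continuous_on_eq_continuous_at)
      then show "(\<lambda>n. \<integral>y. f (x, y) \<partial>\<nu>n n) \<longlonglongrightarrow> (\<integral>y. f (x, y) \<partial>\<nu>)"
        using K by (intro weak_conv_imp_integral_bdd_continuous_conv[OF \<nu>n \<nu> conv]) auto
    qed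
    show "AE x in \<mu>. norm (\<integral>y. f (x, y) \<partial>\<nu>n n) \<le> K" for n
    proof (rule AE_I2)
      fix x
      interpret \<nu>n: real_distribution "\<nu>n n" by (rule \<nu>n)
      have "(\<lambda>y. f (x, y)) \<in> borel_measurable (\<nu>n n)" by simp
      then have "integrable (\<nu>n n) (\<lambda>y. f (x, y))"
        using K by (intro \<nu>n.integrable_const_bound[of _ K]) auto
      then have "norm (\<integral>y. f (x, y) \<partial>\<nu>n n) \<le> (\<integral>y. norm (f (x, y)) \<partial>\<nu>n n)"
        by (intro integral_norm_bound)
      also have "\<dots> \<le> (\<integral>y. K \<partial>\<nu>n n)"
        using \<open>integrable (\<nu>n n) (\<lambda>y. f (x, y))\<close> K by (intro integral_mono) auto
      also have "\<dots> = K" using \<nu>n.prob_space by simp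
      finally show "norm (\<integral>y. f (x, y) \<partial>\<nu>n n) \<le> K" .
    qed
  qed (auto intro!: meas \<nu> \<nu>n)
  then show "(\<lambda>n. integral\<^sup>L (\<mu> \<Otimes>\<^sub>M \<nu>n n) f) \<longlonglongrightarrow> integral\<^sup>L (\<mu> \<Otimes>\<^sub>M \<nu>) f"
    by (simp add: iterated \<nu> \<nu>n)
qed

text \<open>The probabilistic half of the theorem, freed from matrices. Independence is assumed
  within each row only, and the formulas for S and F only for nonempty samples.\<close>

lemma (in prob_space) std_normal_array_limits:
  fixes Y :: "nat \<Rightarrow> nat \<Rightarrow> 'a \<Rightarrow> real" and S F :: "nat \<Rightarrow> 'a \<Rightarrow> real"
  assumes \<alpha>: "0 < \<alpha>"
    and Y [measurable]: "\<And>N i. Y N i \<in> borel_measurable M"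
    and indep: "\<And>N. 1 \<le> N \<Longrightarrow> indep_vars (\<lambda>_. borel) (Y N) {..<N}"
    and law: "\<And>N i. i < N \<Longrightarrow> distr M borel (Y N i) = std_normal_distribution"
    and S: "\<And>N \<omega>. 1 \<le> N \<Longrightarrow> S N \<omega> = \<alpha> * Y N 0 \<omega>"
    and F: "\<And>N \<omega>. 1 \<le> N \<Longrightarrow> F N \<omega> = ((\<Sum>i\<in>{1..<N}. (Y N i \<omega>)\<^sup>2) - real N) / sqrt (2 * real N)"
  shows "(\<forall>N\<ge>1. distributed M lborel (S N) (normal_density 0 \<alpha>)) \<and>
    weak_conv_m (\<lambda>N. distr M borel (S N)) (density lborel (normal_density 0 \<alpha>)) \<and>
    weak_conv_m (\<lambda>N. distr M borel (F N)) std_normal_distribution \<and>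
    (\<forall>N\<ge>1. indep_var borel (S N) borel (F N)) \<and>
    weak_conv_law (\<lambda>N. distr M borel (\<lambda>\<omega>. (S N \<omega>, F N \<omega>))) (bivariate_normal_law (\<alpha>\<^sup>2) 0 1)"
proof -
  have S_eq: "S N = (\<lambda>\<omega>. \<alpha> * Y N 0 \<omega>)" if "1 \<le> N" for N
    using S[OF that] by auto
  have F_eq: "F N = (\<lambda>\<omega>. ((\<Sum>i\<in>{1..<N}. (Y N i \<omega>)\<^sup>2) - real N) / sqrt (2 * real N))" if "1 \<le> N" for N
    using F[OF that] by auto
  have S_meas: "S N \<in> borel_measurable M" and F_meas: "F N \<in> borel_measurable M" if "1 \<le> N" for N
    using that by (simp_all add: S_eq F_eq)
  have S_law: "distr M borel (S N) = density lborel (normal_density 0 \<alpha>)" if "1 \<le> N" for N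
  proof -
    have "distr (distr M borel (Y N 0)) borel (\<lambda>x. \<alpha> * x) = distr M borel (S N)"
      unfolding S_eq[OF that] by (subst distr_distr) (simp_all add: comp_def)
    then show ?thesis
      using that normal_density_scale_std[OF \<alpha>] by (simp only: law[of 0 N] less_le_trans[OF zero_less_one])
  qed
  have S_dist: "distributed M lborel (S N) (normal_density 0 \<alpha>)" if "1 \<le> N" for N
  proof -
    have "distr M lborel (S N) = distr M borel (S N)" by (rule distr_cong) auto
    then show ?thesis
      unfolding distributed_def using S_law[OF that] S_meas[OF that] by simp
  qed
  have S_conv: "weak_conv_m (\<lambda>N. distr M borel (S N)) (density lborel (normal_density 0 \<alpha>))"
    by (rule weak_conv_m_Suc) (simp add: S_law weak_conv_m_def weak_conv_def)
  have char_F: "char (distr M borel (F N)) t = char chi_sq_dev (t / sqrt (2 * real N)) ^ (N - 1) * iexp (- t / sqrt (2 * real N))"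
    if N: "1 \<le> N" for N t
  proof -
    let ?r = "sqrt (2 * real N)"
    have ind: "indep_vars (\<lambda>_. borel) (\<lambda>i \<omega>. (Y N i \<omega>)\<^sup>2 - 1) {1..<N}"
      by (rule indep_vars_subset[OF indep_vars_compose2[OF indep[OF N], where Y = "\<lambda>_ x. x\<^sup>2 - 1"]]) auto
    have dev: "distr M borel (\<lambda>\<omega>. (Y N i \<omega>)\<^sup>2 - 1) = chi_sq_dev" if "i < N" for i
    proof -
      have "distr (distr M borel (Y N i)) borel (\<lambda>x. x\<^sup>2 - 1) = distr M borel (\<lambda>\<omega>. (Y N i \<omega>)\<^sup>2 - 1)"
        by (subst distr_distr) (simp_all add: comp_def)
      then show ?thesis unfolding law[OF that] chi_sq_dev_def by (rule sym)
    qed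
    \<comment> \<open>There are N - 1 squares but N is subtracted: centring each square by 1 leaves
      - 1, whence the phase \<open>iexp (- t / ?r)\<close>.\<close>
    have "t * F N \<omega> = (t / ?r) * (\<Sum>i\<in>{1..<N}. (Y N i \<omega>)\<^sup>2 - 1) + (- t / ?r)" for \<omega>
    proof -
      have "(\<Sum>i\<in>{1..<N}. (Y N i \<omega>)\<^sup>2 - 1) = (\<Sum>i\<in>{1..<N}. (Y N i \<omega>)\<^sup>2) - (real N - 1)"
        using N by (simp add: sum_subtractf)
      moreover have "t * ((A - n) / r) = t / r * (A - (n - 1)) + - t / r" for A n r :: real
        by (cases "r = 0") (simp_all add: field_simps)
      ultimately show ?thesis
        by (simp only: F[OF N])
    qed
    then have "char (distr M borel (F N)) t
        = (\<integral>\<omega>. iexp ((t / ?r) * (\<Sum>i\<in>{1..<N}. (Y N i \<omega>)\<^sup>2 - 1)) * iexp (- t / ?r) \<partial>M)"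
      unfolding char_def using F_meas[OF N]
      by (subst integral_distr) (simp_all only: exp_add[symmetric] distrib_left[symmetric] of_real_add[symmetric], simp_all)
    also have "\<dots> = char (distr M borel (\<lambda>\<omega>. \<Sum>i\<in>{1..<N}. (Y N i \<omega>)\<^sup>2 - 1)) (t / ?r) * iexp (- t / ?r)"
      unfolding char_def by (subst integral_distr) auto
    also have "char (distr M borel (\<lambda>\<omega>. \<Sum>i\<in>{1..<N}. (Y N i \<omega>)\<^sup>2 - 1)) (t / ?r) = char chi_sq_dev (t / ?r) ^ (N - 1)"
      by (subst char_distr_sum[OF ind]) (simp add: dev)
    finally show ?thesis .
  qed
  have F_conv_Suc: "weak_conv_m (\<lambda>n. distr M borel (F (Suc n))) std_normal_distribution"
  proof (rule levy_continuity)
    fix t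
    have "(\<lambda>n. char (distr M borel (F (Suc n))) t) \<longlonglongrightarrow> exp (- (t\<^sup>2) / 2)"
      using LIMSEQ_Suc[OF char_chi_sq_dev_power_pred_tendsto[of t]] by (subst char_F) simp_all
    then show "(\<lambda>n. char (distr M borel (F (Suc n))) t) \<longlonglongrightarrow> char std_normal_distribution t"
      by (simp add: char_std_normal_distribution)
  qed (auto intro!: real_dist_normal_dist real_distribution_distr F_meas)
  have indep_SF: "indep_var borel (S N) borel (F N)" if N: "1 \<le> N" for N
  proof -
    \<comment> \<open>S and F depend on disjoint blocks of one independent row. For N = 1 the second
      block is empty and F is constant.\<close>
    have "indep_var (Pi\<^sub>M {0} (\<lambda>_. borel)) (\<lambda>\<omega>. restrict (\<lambda>i. Y N i \<omega>) {0})
        (Pi\<^sub>M {1..<N} (\<lambda>_. borel)) (\<lambda>\<omega>. restrict (\<lambda>i. Y N i \<omega>) {1..<N})"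
      using N by (intro indep_var_restrict[OF indep[OF N]]) auto
    then have "indep_var borel ((\<lambda>y. \<alpha> * y 0) \<circ> (\<lambda>\<omega>. restrict (\<lambda>i. Y N i \<omega>) {0}))
        borel ((\<lambda>y. ((\<Sum>i\<in>{1..<N}. (y i)\<^sup>2) - real N) / sqrt (2 * real N)) \<circ> (\<lambda>\<omega>. restrict (\<lambda>i. Y N i \<omega>) {1..<N}))"
      by (rule indep_var_compose) auto
    moreover have "(\<lambda>y. \<alpha> * y 0) \<circ> (\<lambda>\<omega>. restrict (\<lambda>i. Y N i \<omega>) {0}) = S N"
      using N by (auto simp: S)
    moreover have "(\<lambda>y. ((\<Sum>i\<in>{1..<N}. (y i)\<^sup>2) - real N) / sqrt (2 * real N)) \<circ> (\<lambda>\<omega>. restrict (\<lambda>i. Y N i \<omega>) {1..<N}) = F N"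
      using N by (auto simp: F)
    ultimately show ?thesis by simp
  qed
  have joint: "distr M borel (\<lambda>\<omega>. (S N \<omega>, F N \<omega>)) = density lborel (normal_density 0 \<alpha>) \<Otimes>\<^sub>M distr M borel (F N)"
    if N: "1 \<le> N" for N
    using indep_SF[OF N] unfolding indep_var_distribution_eq S_law[OF N] borel_prod by simp
  have "weak_conv_law (\<lambda>n. density lborel (normal_density 0 \<alpha>) \<Otimes>\<^sub>M distr M borel (F (Suc n)))
      (density lborel (normal_density 0 \<alpha>) \<Otimes>\<^sub>M std_normal_distribution)"
  proof (rule weak_conv_law_pair_fixed)
    show "real_distribution (density lborel (normal_density 0 \<alpha>))"
      using real_distribution_distr[OF S_meas[of 1]] S_law[of 1] by simp
  qed (auto intro!: real_dist_normal_dist real_distribution_distr F_meas F_conv_Suc)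
  then have "weak_conv_law (\<lambda>n. distr M borel (\<lambda>\<omega>. (S (Suc n) \<omega>, F (Suc n) \<omega>))) (bivariate_normal_law (\<alpha>\<^sup>2) 0 1)"
    by (simp add: joint bivariate_normal_law_diagonal[OF \<alpha>])
  then have "weak_conv_law (\<lambda>N. distr M borel (\<lambda>\<omega>. (S N \<omega>, F N \<omega>))) (bivariate_normal_law (\<alpha>\<^sup>2) 0 1)"
    unfolding weak_conv_law_def by (subst (asm) filterlim_sequentially_Suc) blast
  with S_dist S_conv weak_conv_m_Suc[OF F_conv_Suc] indep_SF show ?thesis by blast
qed

section \<open>Whitening\<close>

lemma mult_mat_vec_scalar_prod_symmetric:
  fixes G :: "real mat"
  assumes G: "G \<in> carrier_mat N N" "transpose_mat G = G" and v: "v \<in> carrier_vec N" and w: "w \<in> carrier_vec N"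
  shows "(G *\<^sub>v v) \<bullet> w = v \<bullet> (G *\<^sub>v w)"
  using transpose_vec_mult_scalar[OF G(1) v w] G v w
  by (metis comm_scalar_prod mult_mat_vec_carrier transpose_vec_mult_scalar)

text \<open>A new direction is found as a kernel vector of a singular matrix: its first k rows are
  \<open>G *\<^sub>v u i\<close> and row k is zero, so some nonzero v is orthogonal to all earlier
  vectors for the form of G. Positive definiteness allows v to be normalised.\<close>

lemma orthonormal_extension:
  fixes G :: "real mat"
  assumes G: "G \<in> carrier_mat N N" "transpose_mat G = G"
    and pd: "\<And>v. v \<in> carrier_vec N \<Longrightarrow> v \<noteq> 0\<^sub>v N \<Longrightarrow> 0 < v \<bullet> (G *\<^sub>v v)"
    and e: "e \<in> carrier_vec N" "e \<bullet> (G *\<^sub>v e) = 1"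
    and k: "1 \<le> k" "k \<le> N"
  shows "\<exists>u. u 0 = e \<and> (\<forall>i<k. u i \<in> carrier_vec N) \<and>
    (\<forall>i<k. \<forall>j<k. u i \<bullet> (G *\<^sub>v u j) = (if i = j then 1 else 0))"
  using k
proof (induction k rule: dec_induct)
  case base
  then show ?case using e by (intro exI[of _ "\<lambda>_. e"]) auto
next
  case (step k)
  then obtain u where u: "u 0 = e" "\<And>i. i < k \<Longrightarrow> u i \<in> carrier_vec N"
    "\<And>i j. i < k \<Longrightarrow> j < k \<Longrightarrow> u i \<bullet> (G *\<^sub>v u j) = (if i = j then 1 else 0)"
    by auto
  define c where "c i = (if i < k then G *\<^sub>v u i else 0\<^sub>v N)" for i
  define A where "A = mat\<^sub>r N N (\<lambda>i. if i = k then 0\<^sub>v N else c i)"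
  have A: "A \<in> carrier_mat N N" by (simp add: A_def)
  have "Determinant.det A = 0"
    unfolding A_def using step.hyps step.prems G(1) u(2) by (intro det_row_0) (auto simp: c_def)
  then obtain v where v: "v \<in> carrier_vec N" "v \<noteq> 0\<^sub>v N" "A *\<^sub>v v = 0\<^sub>v N"
    using det_0_iff_vec_prod_zero_field[OF A] by blast
  have orth: "u i \<bullet> (G *\<^sub>v v) = 0" if "i < k" for i
  proof -
    have "row A i = G *\<^sub>v u i"
      using that step.prems G(1) u(2)[OF that] by (simp add: A_def c_def)
    moreover have "(A *\<^sub>v v) $ i = 0" using v(3) that step.prems by simp
    ultimately have "(G *\<^sub>v u i) \<bullet> v = 0"
      using that step.prems A by (simp add: index_mult_mat_vec)
    then show ?thesis
      using mult_mat_vec_scalar_prod_symmetric[OF G u(2)[OF that] v(1)] by simp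
  qed
  define q where "q = sqrt (v \<bullet> (G *\<^sub>v v))"
  have q: "0 < q" "q * q = v \<bullet> (G *\<^sub>v v)"
    using pd[OF v(1,2)] by (simp_all add: q_def)
  define w where "w = (1 / q) \<cdot>\<^sub>v v"
  have w: "w \<in> carrier_vec N" using v(1) by (simp add: w_def)
  have Gw: "G *\<^sub>v w = (1 / q) \<cdot>\<^sub>v (G *\<^sub>v v)"
    unfolding w_def by (rule mult_mat_vec[OF G(1) v(1)])
  have "w \<bullet> (G *\<^sub>v w) = 1"
    unfolding Gw using G(1) v(1) q pd[OF v(1,2)] by (simp add: w_def)
  moreover have orth_w: "u i \<bullet> (G *\<^sub>v w) = 0" if "i < k" for i
    unfolding Gw using G(1) v(1) u(2)[OF that] orth[OF that] by simp
  moreover have "w \<bullet> (G *\<^sub>v u i) = 0" if "i < k" for i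
    using orth_w[OF that] mult_mat_vec_scalar_prod_symmetric[OF G w u(2)[OF that]]
      comm_scalar_prod[of "G *\<^sub>v w" N "u i"] G(1) w u(2)[OF that] by simp
  ultimately show ?case
    using u w step.hyps by (intro exI[of _ "u(k := w)"]) (auto simp: less_Suc_eq)
qed

text \<open>A kernel vector would make the quadratic form vanish, so the determinant is nonzero and
  \<open>the\<close> is applied to an actual inverse.\<close>

lemma mat_inverse_positive_definite:
  fixes G :: "real mat"
  assumes G: "G \<in> carrier_mat N N"
    and pd: "\<And>v. v \<in> carrier_vec N \<Longrightarrow> v \<noteq> 0\<^sub>v N \<Longrightarrow> 0 < v \<bullet> (G *\<^sub>v v)"
  defines "J \<equiv> the (mat_inverse G)"
  shows "J \<in> carrier_mat N N" "G * J = 1\<^sub>m N" "J * G = 1\<^sub>m N"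
proof -
  have "Determinant.det G \<noteq> 0"
  proof
    assume "Determinant.det G = 0"
    then obtain v where v: "v \<in> carrier_vec N" "v \<noteq> 0\<^sub>v N" "G *\<^sub>v v = 0\<^sub>v N"
      using det_0_iff_vec_prod_zero_field[OF G] by blast
    with pd[OF v(1,2)] show False by simp
  qed
  then have "G \<in> Units (ring_mat TYPE(real) N ())"
    by (rule det_non_zero_imp_unit[OF G])
  then have "mat_inverse G = Some J"
    using mat_inverse(1)[OF G, where b = "()"] by (cases "mat_inverse G") (auto simp: J_def)
  from mat_inverse(2)[OF G this]
  show "J \<in> carrier_mat N N" "G * J = 1\<^sub>m N" "J * G = 1\<^sub>m N" by auto
qed

text \<open>With the u i as rows of U, orthonormality reads
  \<open>U * (G * transpose_mat U) = 1\<^sub>m N\<close>. Hence the inverse of G is the transpose of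
  U times U, and its quadratic form is a sum of squares. The choice of u 0 makes T equal to sqrt d
  times G u 0, so T is orthogonal to every other u i.\<close>

lemma whitening_vectors:
  fixes G :: "real mat" and T :: "real vec"
  assumes G: "G \<in> carrier_mat N N" "transpose_mat G = G"
    and pd: "\<And>v. v \<in> carrier_vec N \<Longrightarrow> v \<noteq> 0\<^sub>v N \<Longrightarrow> 0 < v \<bullet> (G *\<^sub>v v)"
    and T: "T \<in> carrier_vec N" "T \<noteq> 0\<^sub>v N"
  defines "J \<equiv> the (mat_inverse G)"
  defines "d \<equiv> T \<bullet> (J *\<^sub>v T)"
  obtains u where "0 < d" "\<And>i. i < N \<Longrightarrow> u i \<in> carrier_vec N"
    "\<And>i j. i < N \<Longrightarrow> j < N \<Longrightarrow> u i \<bullet> (G *\<^sub>v u j) = (if i = j then 1 else 0)"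
    "\<And>i. i < N \<Longrightarrow> u i \<bullet> T = (if i = 0 then sqrt d else 0)"
    "\<And>z. z \<in> carrier_vec N \<Longrightarrow> z \<bullet> (J *\<^sub>v z) = (\<Sum>i<N. (u i \<bullet> z)\<^sup>2)"
    "\<And>z. z \<in> carrier_vec N \<Longrightarrow> T \<bullet> (J *\<^sub>v z) = sqrt d * (u 0 \<bullet> z)"
proof -
  have J: "J \<in> carrier_mat N N" "G * J = 1\<^sub>m N" "J * G = 1\<^sub>m N"
    unfolding J_def by (rule mat_inverse_positive_definite[OF G(1) pd]; assumption)+
  define s where "s = J *\<^sub>v T"
  have s: "s \<in> carrier_vec N" using J T by (simp add: s_def)
  have Gs: "G *\<^sub>v s = T"
    unfolding s_def using G(1) J T(1) by (subst assoc_mult_mat_vec[symmetric]) auto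
  have N: "1 \<le> N"
    using T by (cases N) auto
  have "s \<noteq> 0\<^sub>v N"
    using Gs T(2) G(1) by auto
  then have "0 < s \<bullet> (G *\<^sub>v s)" by (rule pd[OF s])
  also have "s \<bullet> (G *\<^sub>v s) = d"
    unfolding Gs d_def using comm_scalar_prod[OF s T(1)] by (simp add: s_def)
  finally have d: "0 < d" .
  define r where "r = sqrt d"
  have r: "0 < r" "r * r = d" using d by (simp_all add: r_def)
  \<comment> \<open>Since \<open>s \<bullet> (G *\<^sub>v s) = d\<close>, division by the root of d
    makes s a unit vector for the form of G.\<close>
  define e where "e = (1 / r) \<cdot>\<^sub>v s"
  have e: "e \<in> carrier_vec N" using s by (simp add: e_def)
  have Ge: "G *\<^sub>v e = (1 / r) \<cdot>\<^sub>v T"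
    unfolding e_def Gs[symmetric] by (rule mult_mat_vec[OF G(1) s])
  have "e \<bullet> (G *\<^sub>v e) = 1"
    unfolding Ge using s T r d \<open>s \<bullet> (G *\<^sub>v s) = d\<close> by (simp add: e_def Gs)
  from orthonormal_extension[OF G pd e this N order_refl]
  obtain u where u0: "u 0 = e" and u: "\<And>i. i < N \<Longrightarrow> u i \<in> carrier_vec N"
    and ortho: "\<And>i j. i < N \<Longrightarrow> j < N \<Longrightarrow> u i \<bullet> (G *\<^sub>v u j) = (if i = j then 1 else 0)"
    by metis
  have uT: "u i \<bullet> T = (if i = 0 then sqrt d else 0)" if "i < N" for i
  proof -
    have "T = r \<cdot>\<^sub>v (G *\<^sub>v u 0)"
      unfolding u0 Ge using r by (simp add: smult_smult_assoc)
    then have "u i \<bullet> T = r * (u i \<bullet> (G *\<^sub>v u 0))"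
      using u[OF that] G(1) u[of 0] N by (metis mult_mat_vec_carrier scalar_prod_smult_right less_eq_Suc_le One_nat_def carrier_vecD)
    then show ?thesis using ortho[OF that, of 0] N by (simp add: r_def)
  qed
  define U where "U = mat\<^sub>r N N u"
  have U: "U \<in> carrier_mat N N" by (simp add: U_def)
  have row_U: "row U i = u i" if "i < N" for i
    using that u[OF that] by (simp add: U_def)
  have "U * (G * transpose_mat U) = 1\<^sub>m N"
  proof (rule eq_matI)
    fix i j assume ij: "i < dim_row (1\<^sub>m N :: real mat)" "j < dim_col (1\<^sub>m N :: real mat)"
    then have "(U * (G * transpose_mat U)) $$ (i, j) = row U i \<bullet> col (G * transpose_mat U) j"
      using U G(1) by simp
    also have "col (G * transpose_mat U) j = G *\<^sub>v col (transpose_mat U) j"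
      using U G(1) ij by (intro col_mult2[of _ N N _ N]) auto
    also have "col (transpose_mat U) j = row U j"
      using U ij by simp
    finally show "(U * (G * transpose_mat U)) $$ (i, j) = 1\<^sub>m N $$ (i, j)"
      using ij by (simp add: row_U ortho)
  qed (use U G in auto)
  \<comment> \<open>For square matrices a right inverse is also a left inverse; this brings the two
    factors U together.\<close>
  then have "(G * transpose_mat U) * U = 1\<^sub>m N"
    using U G(1) by (intro mat_mult_left_right_inverse[of U N]) auto
  then have "G * (transpose_mat U * U) = 1\<^sub>m N"
    using U G(1) by (subst (asm) assoc_mult_mat[of _ N N _ N _ N]) auto
  then have "J * (G * (transpose_mat U * U)) = J"
    using J by simp
  moreover have "J * (G * (transpose_mat U * U)) = (J * G) * (transpose_mat U * U)"
    using J(1) G(1) U by (intro assoc_mult_mat[symmetric, of _ N N _ N _ N]) auto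
  ultimately have JU: "J = transpose_mat U * U"
    using J U by simp
  have quad: "z \<bullet> (J *\<^sub>v z) = (\<Sum>i<N. (u i \<bullet> z)\<^sup>2)" if z: "z \<in> carrier_vec N" for z
  proof -
    have "z \<bullet> (J *\<^sub>v z) = z \<bullet> (transpose_mat U *\<^sub>v (U *\<^sub>v z))"
      unfolding JU using U z by (subst assoc_mult_mat_vec[of _ N N _ N]) auto
    also have "\<dots> = (U *\<^sub>v z) \<bullet> (U *\<^sub>v z)"
      using transpose_vec_mult_scalar[OF U z, of "U *\<^sub>v z"] U z
        comm_scalar_prod[of z N "transpose_mat U *\<^sub>v (U *\<^sub>v z)"] by simp
    also have "\<dots> = (\<Sum>i<N. (u i \<bullet> z)\<^sup>2)"
      using U z by (auto simp: scalar_prod_def[of "U *\<^sub>v z"] row_U power2_eq_square atLeast0LessThan intro!: sum.cong)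
    finally show ?thesis .
  qed
  have lin: "T \<bullet> (J *\<^sub>v z) = sqrt d * (u 0 \<bullet> z)" if z: "z \<in> carrier_vec N" for z
  proof -
    have "T \<bullet> (J *\<^sub>v z) = (G *\<^sub>v s) \<bullet> (J *\<^sub>v z)"
      by (simp add: Gs)
    also have "\<dots> = s \<bullet> (G *\<^sub>v (J *\<^sub>v z))"
      using J(1) z by (intro mult_mat_vec_scalar_prod_symmetric[OF G s]) simp
    also have "G *\<^sub>v (J *\<^sub>v z) = z"
      using G(1) J z by (subst assoc_mult_mat_vec[symmetric]) auto
    also have "s \<bullet> z = r * (u 0 \<bullet> z)"
      using r s z by (simp add: u0 e_def)
    finally show ?thesis by (simp add: r_def)
  qed
  show ?thesis
    by (rule that[of u]) (fact d | fact u | fact ortho | fact uT | fact quad | fact lin)+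
qed

section \<open>Covariance matrix and characteristic function of the summed motions\<close>

lemma fbm_cov_commute: "fbm_cov H s t = fbm_cov H t s"
  by (simp add: fbm_cov_def abs_minus_commute)

lemma fbm_cov_mat_carrier: "fbm_cov_mat h m H N \<in> carrier_mat N N"
  by (simp add: fbm_cov_mat_def)

lemma fbm_cov_mat_index:
  assumes "i < N" "j < N"
  shows "fbm_cov_mat h m H N $$ (i, j) = (\<Sum>r=1..m. fbm_cov (H r) (real (Suc i) * h) (real (Suc j) * h))"
proof -
  have "fbm_cov_mat h m H N $$ (i, j) = (\<Sum>r=1..m. fbm_cov (H r) (real (Suc j) * h) (real (Suc i) * h))"
    using assms by (simp add: fbm_cov_mat_def obs_time_def fbm_cov_def Let_def sum_divide_distrib add.commute)
  then show ?thesis by (simp only: fbm_cov_commute)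
qed

lemma fbm_cov_mat_transpose: "transpose_mat (fbm_cov_mat h m H N) = fbm_cov_mat h m H N"
proof (rule eq_matI)
  fix i j assume "i < dim_row (fbm_cov_mat h m H N)" "j < dim_col (fbm_cov_mat h m H N)"
  then have ij: "i < N" "j < N" using fbm_cov_mat_carrier[of h m H N] by auto
  then have "transpose_mat (fbm_cov_mat h m H N) $$ (i, j) = fbm_cov_mat h m H N $$ (j, i)"
    using fbm_cov_mat_carrier[of h m H N] by simp
  also have "\<dots> = fbm_cov_mat h m H N $$ (i, j)"
    using ij by (simp only: fbm_cov_mat_index) (intro sum.cong refl fbm_cov_commute)
  finally show "transpose_mat (fbm_cov_mat h m H N) $$ (i, j) = fbm_cov_mat h m H N $$ (i, j)" .
qed (use fbm_cov_mat_carrier[of h m H N] in auto)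

lemma fbm_cov_mat_bilinear:
  assumes "v \<in> carrier_vec N" "w \<in> carrier_vec N"
  shows "v \<bullet> (fbm_cov_mat h m H N *\<^sub>v w)
    = (\<Sum>r=1..m. \<Sum>i<N. \<Sum>j<N. v $ i * w $ j * fbm_cov (H r) (real (Suc i) * h) (real (Suc j) * h))"
proof -
  let ?c = "\<lambda>r i j. fbm_cov (H r) (real (Suc i) * h) (real (Suc j) * h)"
  have "v \<bullet> (fbm_cov_mat h m H N *\<^sub>v w) = (\<Sum>i<N. v $ i * (\<Sum>j<N. fbm_cov_mat h m H N $$ (i, j) * w $ j))"
    using assms fbm_cov_mat_carrier[of h m H N]
    by (simp add: scalar_prod_def atLeast0LessThan)
  also have "\<dots> = (\<Sum>i<N. \<Sum>j<N. \<Sum>r=1..m. v $ i * w $ j * ?c r i j)"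
    by (simp add: fbm_cov_mat_index sum_distrib_left sum_distrib_right mult_ac)
  also have "\<dots> = (\<Sum>i<N. \<Sum>r=1..m. \<Sum>j<N. v $ i * w $ j * ?c r i j)"
    by (intro sum.cong refl sum.swap)
  also have "\<dots> = (\<Sum>r=1..m. \<Sum>i<N. \<Sum>j<N. v $ i * w $ j * ?c r i j)"
    by (rule sum.swap)
  finally show ?thesis .
qed

text \<open>The quadratic form is a sum over r of variances, each nonnegative; the motion with r =
  1, present because m >= 1, makes it strictly positive.\<close>

lemma (in prob_space) fbm_cov_mat_positive_definite:
  assumes H: "\<And>r. r \<in> {1..m} \<Longrightarrow> H r < 1" and m: "1 \<le> m" and h: "0 < h"
    and fbm: "\<And>r. r \<in> {1..m} \<Longrightarrow> fractional_brownian_motion M (H r) (B r)"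
    and v: "v \<in> carrier_vec N" "v \<noteq> 0\<^sub>v N"
  shows "0 < v \<bullet> (fbm_cov_mat h m H N *\<^sub>v v)"
proof -
  define Q where "Q r = (\<Sum>i<N. \<Sum>j<N. v $ i * v $ j * fbm_cov (H r) (real (Suc i) * h) (real (Suc j) * h))" for r
  have nonneg: "0 \<le> Q r" if "r \<in> {1..m}" for r
    unfolding Q_def using h
    by (intro fbm_combination_law(1)[OF fbm[OF that], where \<tau> = "\<lambda>i. real (Suc i) * h"]) (auto simp: inj_on_def)
  have "Q 1 \<noteq> 0"
  proof
    assume "Q 1 = 0"
    have 1: "1 \<in> {1..m}" using m by simp
    have "v $ i = 0" if "i < N" for i
      using \<open>Q 1 = 0\<close> that unfolding Q_def
      by (intro fbm_cov_positive_definite[OF fbm[OF 1] H[OF 1] h])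
    then have "v = 0\<^sub>v N" using v(1) by auto
    with v(2) show False by contradiction
  qed
  then have "0 < Q 1" using nonneg[of 1] m by simp
  then have "0 < (\<Sum>r=1..m. Q r)"
    using m nonneg by (intro sum_pos2[of _ 1]) auto
  then show ?thesis
    by (simp add: fbm_cov_mat_bilinear[OF v(1) v(1)] Q_def)
qed

text \<open>The part \<open>X r\<close> of the combination reads finitely many coordinates of the
  path of \<open>B r\<close>, so independence of the paths passes to the \<open>X r\<close>. Their
  normal characteristic functions multiply, and the exponents add up to the quadratic form.\<close>

lemma (in prob_space) mixed_fbm_combination_char:
  assumes h: "0 < h"
    and fbm: "\<And>r. r \<in> {1..m} \<Longrightarrow> fractional_brownian_motion M (H r) (B r)"
    and indep: "independent_processes M {1..m} B"
    and v: "v \<in> carrier_vec N"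
  shows "(\<integral>\<omega>. iexp (\<Sum>j<N. v $ j * (\<Sum>r=1..m. B r (real (Suc j) * h) \<omega>)) \<partial>M)
    = exp (- (v \<bullet> (fbm_cov_mat h m H N *\<^sub>v v)) / 2)"
proof -
  define \<tau> where "\<tau> j = real (Suc j) * h" for j
  have \<tau>: "inj_on \<tau> {..<N}" "\<And>j. 0 \<le> \<tau> j"
    using h by (auto simp: \<tau>_def inj_on_def)
  define X where "X r \<omega> = (\<Sum>j<N. v $ j * B r (\<tau> j) \<omega>)" for r \<omega>
  define Q where "Q r = (\<Sum>i<N. \<Sum>j<N. v $ i * v $ j * fbm_cov (H r) (\<tau> i) (\<tau> j))" for r
  have X_indep: "indep_vars (\<lambda>_. borel) X {1..m}"
  proof -
    have "indep_vars (\<lambda>_. borel) (\<lambda>r \<omega>. \<Sum>j<N. v $ j * (\<lambda>t\<in>{0..}. B r t \<omega>) (\<tau> j)) {1..m}"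
    proof (rule indep_vars_compose2[where Y = "\<lambda>_ p. \<Sum>j<N. v $ j * p (\<tau> j)"])
      show "indep_vars (\<lambda>_. Pi\<^sub>M {0..} (\<lambda>_. borel)) (\<lambda>r \<omega>. \<lambda>t\<in>{0..}. B r t \<omega>) {1..m}"
        using indep by (simp add: independent_processes_def)
      have "(\<lambda>p. p (\<tau> j)) \<in> borel_measurable (Pi\<^sub>M {0..} (\<lambda>_. borel))" for j
        using \<tau>(2)[of j] by (intro measurable_component_singleton) simp
      then show "(\<lambda>p. \<Sum>j<N. v $ j * p (\<tau> j)) \<in> borel_measurable (Pi\<^sub>M {0..} (\<lambda>_. borel))"
        by (intro borel_measurable_sum borel_measurable_times) auto
    qed
    then show ?thesis
      using \<tau>(2) by (simp add: X_def[abs_def])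
  qed
  have X_meas: "X r \<in> borel_measurable M" if "r \<in> {1..m}" for r
    using X_indep that unfolding indep_vars_def2 by simp
  have law: "0 \<le> Q r" "distr M borel (X r) = normal_law 0 (Q r)" if "r \<in> {1..m}" for r
    using fbm_combination_law(1,2)[OF fbm[OF that] finite_lessThan \<tau>, of "($) v"]
    unfolding X_def[abs_def] Q_def by simp_all
  have sum_meas: "(\<lambda>\<omega>. \<Sum>r=1..m. X r \<omega>) \<in> borel_measurable M"
    using X_meas by (intro borel_measurable_sum) auto
  have "(\<Sum>j<N. v $ j * (\<Sum>r=1..m. B r (\<tau> j) \<omega>)) = (\<Sum>r=1..m. X r \<omega>)" for \<omega>
    unfolding X_def sum_distrib_left by (rule sum.swap)
  then have "(\<integral>\<omega>. iexp (\<Sum>j<N. v $ j * (\<Sum>r=1..m. B r (\<tau> j) \<omega>)) \<partial>M)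
      = (\<integral>\<omega>. iexp (1 * (\<Sum>r=1..m. X r \<omega>)) \<partial>M)"
    by (simp only: mult_1)
  \<comment> \<open>Evaluation at 1 loses nothing, since the vector v is arbitrary.\<close>
  also have "\<dots> = char (distr M borel (\<lambda>\<omega>. \<Sum>r=1..m. X r \<omega>)) 1"
    unfolding char_def using sum_meas by (subst integral_distr) auto
  also have "\<dots> = (\<Prod>r=1..m. char (distr M borel (X r)) 1)"
    by (rule char_distr_sum[OF X_indep])
  also have "\<dots> = (\<Prod>r=1..m. of_real (exp (- Q r / 2)))"
    using law by (intro prod.cong) (auto simp: char_normal_law_0)
  also have "\<dots> = of_real (exp (\<Sum>r=1..m. - Q r / 2))"
    by (simp only: exp_sum[OF finite_atLeastAtMost] of_real_prod)
  also have "(\<Sum>r=1..m. - Q r / 2) = - (v \<bullet> (fbm_cov_mat h m H N *\<^sub>v v)) / 2"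
    by (simp add: fbm_cov_mat_bilinear[OF v v] Q_def \<tau>_def sum_negf sum_divide_distrib)
  finally show ?thesis by (simp only: \<tau>_def)
qed

text \<open>A combination of the \<open>Y i\<close> with coefficients c is a combination of the
  noise with coefficient vector a, the sum of the c i u i. Orthonormality turns the quadratic form
  of a into the sum of the squares of c, and the resulting exponential factorises over i.\<close>

lemma (in prob_space) whitened_fbm_iid:
  fixes u :: "nat \<Rightarrow> real vec"
  assumes h: "0 < h"
    and fbm: "\<And>r. r \<in> {1..m} \<Longrightarrow> fractional_brownian_motion M (H r) (B r)"
    and indep: "independent_processes M {1..m} B"
    and u: "\<And>i. i < N \<Longrightarrow> u i \<in> carrier_vec N"
    and ortho: "\<And>i j. i < N \<Longrightarrow> j < N \<Longrightarrow>
      u i \<bullet> (fbm_cov_mat h m H N *\<^sub>v u j) = (if i = j then 1 else 0)"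
  defines "Y \<equiv> \<lambda>i \<omega>. \<Sum>j<N. u i $ j * (\<Sum>r=1..m. B r (real (Suc j) * h) \<omega>)"
  shows "\<And>i. Y i \<in> borel_measurable M"
    "indep_vars (\<lambda>_. borel) Y {..<N}"
    "\<And>i. i < N \<Longrightarrow> distr M borel (Y i) = std_normal_distribution"
proof -
  let ?G = "fbm_cov_mat h m H N"
  let ?W = "\<lambda>j \<omega>. \<Sum>r=1..m. B r (real (Suc j) * h) \<omega>"
  have "B r (real (Suc j) * h) \<in> borel_measurable M" if "r \<in> {1..m}" for r j
    using fbm[OF that] h by (simp add: fractional_brownian_motion_def gaussian_process_def)
  then show Y_meas [measurable]: "Y i \<in> borel_measurable M" for i
    unfolding Y_def by (intro borel_measurable_sum borel_measurable_times) auto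
  have char_Y: "(\<integral>\<omega>. iexp (\<Sum>i<N. c i * Y i \<omega>) \<partial>M) = exp (- (\<Sum>i<N. (c i)\<^sup>2) / 2)" for c
  proof -
    define a where "a = vec N (\<lambda>j. \<Sum>i<N. c i * u i $ j)"
    have a: "a \<in> carrier_vec N" by (simp add: a_def)
    have "(\<Sum>i<N. c i * Y i \<omega>) = (\<Sum>j<N. a $ j * ?W j \<omega>)" for \<omega>
    proof -
      have "(\<Sum>i<N. c i * Y i \<omega>) = (\<Sum>i<N. \<Sum>j<N. c i * u i $ j * ?W j \<omega>)"
        by (simp only: Y_def sum_distrib_left mult.assoc)
      also have "\<dots> = (\<Sum>j<N. \<Sum>i<N. c i * u i $ j * ?W j \<omega>)"
        by (rule sum.swap)
      also have "\<dots> = (\<Sum>j<N. a $ j * ?W j \<omega>)"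
        by (intro sum.cong refl) (simp add: a_def sum_distrib_right)
      finally show ?thesis .
    qed
    then have "(\<integral>\<omega>. iexp (\<Sum>i<N. c i * Y i \<omega>) \<partial>M) = exp (- (a \<bullet> (?G *\<^sub>v a)) / 2)"
      using mixed_fbm_combination_char[OF h fbm indep a] by simp
    also have "a \<bullet> (?G *\<^sub>v a) = (\<Sum>i<N. (c i)\<^sup>2)"
    proof -
      have left: "a \<bullet> w = (\<Sum>i<N. c i * (u i \<bullet> w))" if "w \<in> carrier_vec N" for w
      proof -
        have "a \<bullet> w = (\<Sum>j<N. \<Sum>i<N. c i * u i $ j * w $ j)"
          using that by (simp add: scalar_prod_def a_def atLeast0LessThan sum_distrib_right)
        also have "\<dots> = (\<Sum>i<N. \<Sum>j<N. c i * u i $ j * w $ j)"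
          by (rule sum.swap)
        also have "\<dots> = (\<Sum>i<N. c i * (u i \<bullet> w))"
          using that by (simp add: scalar_prod_def atLeast0LessThan sum_distrib_left mult.assoc)
        finally show ?thesis .
      qed
      have G: "?G *\<^sub>v w \<in> carrier_vec N" if "w \<in> carrier_vec N" for w
        using fbm_cov_mat_carrier[of h m H N] that by (rule mult_mat_vec_carrier)
      have "u i \<bullet> (?G *\<^sub>v a) = c i" if i: "i < N" for i
      proof -
        have "u i \<bullet> (?G *\<^sub>v a) = (?G *\<^sub>v u i) \<bullet> a"
          by (rule mult_mat_vec_scalar_prod_symmetric[OF fbm_cov_mat_carrier fbm_cov_mat_transpose u[OF i] a, symmetric])
        also have "\<dots> = a \<bullet> (?G *\<^sub>v u i)"
          by (rule comm_scalar_prod[OF G[OF u[OF i]] a])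
        also have "\<dots> = (\<Sum>l<N. c l * (if l = i then 1 else 0))"
          unfolding left[OF G[OF u[OF i]]] using i by (intro sum.cong refl) (simp add: ortho)
        also have "\<dots> = c i" using i by (simp add: if_distrib cong: if_cong)
        finally show ?thesis .
      qed
      then show ?thesis
        unfolding left[OF G[OF a]] by (simp add: power2_eq_square)
    qed
    finally show ?thesis .
  qed
  have law: "distr M borel (Y i) = std_normal_distribution" if i: "i < N" for i
  proof (rule Levy_uniqueness)
    show "char (distr M borel (Y i)) = char std_normal_distribution"
    proof
      fix t
      \<comment> \<open>Frequency t at coordinate i and 0 elsewhere isolates the marginal
        law.\<close>
      define c :: "nat \<Rightarrow> real" where "c j = (if j = i then t else 0)" for j
      have c1: "(\<Sum>j<N. c j * Y j \<omega>) = t * Y i \<omega>" for \<omega>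
        using i by (simp add: c_def if_distrib[of "\<lambda>x. x * _"] cong: if_cong)
      have c2: "(\<Sum>j<N. (c j)\<^sup>2) = t\<^sup>2"
        using i by (simp add: c_def if_distrib[of "\<lambda>x. x\<^sup>2"] cong: if_cong)
      have "char (distr M borel (Y i)) t = (\<integral>\<omega>. iexp (t * Y i \<omega>) \<partial>M)"
        unfolding char_def by (subst integral_distr) auto
      then show "char (distr M borel (Y i)) t = char std_normal_distribution t"
        using char_Y[of c] unfolding c1 c2 char_std_normal_distribution by simp
    qed
  qed (auto intro!: real_distribution_distr real_dist_normal_dist)
  then show "distr M borel (Y i) = std_normal_distribution" if "i < N" for i
    using that .
  show "indep_vars (\<lambda>_. borel) Y {..<N}"
  proof (rule joint_char_product_imp_indep[OF Y_meas law])
    fix c :: "nat \<Rightarrow> real"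
    have "- (\<Sum>i<N. (c i)\<^sup>2) / 2 = (\<Sum>i<N. - (c i)\<^sup>2 / 2)"
      by (simp add: sum_negf sum_divide_distrib)
    then show "(\<integral>\<omega>. iexp (\<Sum>i<N. c i * Y i \<omega>) \<partial>M) = (\<Prod>i<N. char std_normal_distribution (c i))"
      unfolding char_Y char_std_normal_distribution by (simp only: exp_sum[OF finite_lessThan] of_real_prod)
  qed
qed

section \<open>Orthogonal decomposition of the estimators\<close>

text \<open>The time vector sees only coordinate 0 of the observations, which is
  \<open>\<theta> * s + \<alpha> * y 0\<close> with s the root of \<open>d_norm\<close>. Hence the
  term subtracted in the variance estimator is exactly the square of this coordinate, and what
  remains is free of \<theta>.\<close>

lemma estimators_in_whitened_coordinates:
  fixes u :: "nat \<Rightarrow> real vec" and z w :: "real \<Rightarrow> real"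
  assumes N: "1 \<le> N" and \<alpha>: "0 < \<alpha>" and d: "0 < d_norm h m H N"
    and u: "\<And>i. i < N \<Longrightarrow> u i \<in> carrier_vec N"
    and uT: "\<And>i. i < N \<Longrightarrow> u i \<bullet> time_vec h N = (if i = 0 then sqrt (d_norm h m H N) else 0)"
    and quad: "\<And>x. x \<in> carrier_vec N \<Longrightarrow> x \<bullet> (fbm_cov_inv h m H N *\<^sub>v x) = (\<Sum>i<N. (u i \<bullet> x)\<^sup>2)"
    and lin: "\<And>x. x \<in> carrier_vec N \<Longrightarrow>
      time_vec h N \<bullet> (fbm_cov_inv h m H N *\<^sub>v x) = sqrt (d_norm h m H N) * (u 0 \<bullet> x)"
    and z: "\<And>t. z t = \<theta> * t + \<alpha> * w t"
  defines "y \<equiv> \<lambda>i. \<Sum>j<N. u i $ j * w (real (Suc j) * h)"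
  shows "sqrt (d_norm h m H N) * (theta_hat h m H N z - \<theta>) = \<alpha> * y 0"
    and "1 / \<alpha>\<^sup>2 * sqrt (real N / 2) * (alpha_sq_hat h m H N z - \<alpha>\<^sup>2)
      = ((\<Sum>i\<in>{1..<N}. (y i)\<^sup>2) - real N) / sqrt (2 * real N)"
proof -
  define s where "s = sqrt (d_norm h m H N)"
  have s: "0 < s" "d_norm h m H N = s * s" using d by (simp_all add: s_def)
  have oz: "obs_vec h N z \<in> carrier_vec N" by (simp add: obs_vec_def)
  have uz: "u i \<bullet> obs_vec h N z = \<theta> * (if i = 0 then s else 0) + \<alpha> * y i" if i: "i < N" for i
  proof -
    have "u i \<bullet> obs_vec h N z = \<theta> * (u i \<bullet> time_vec h N) + \<alpha> * y i"
      using u[OF i] by (simp add: scalar_prod_def obs_vec_def time_vec_def obs_time_def z y_def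
          atLeast0LessThan sum_distrib_left sum.distrib algebra_simps)
    then show ?thesis by (simp add: uT[OF i] s_def)
  qed
  have th: "time_vec h N \<bullet> (fbm_cov_inv h m H N *\<^sub>v obs_vec h N z) = s * (\<theta> * s + \<alpha> * y 0)"
    using N by (simp add: lin[OF oz] uz s_def)
  show "sqrt (d_norm h m H N) * (theta_hat h m H N z - \<theta>) = \<alpha> * y 0"
    unfolding theta_hat_def th s_def[symmetric] using s by (simp add: field_simps)
  have "(\<Sum>i<N. (u i \<bullet> obs_vec h N z)\<^sup>2) = (\<theta> * s + \<alpha> * y 0)\<^sup>2 + (\<Sum>i\<in>{1..<N}. (\<alpha> * y i)\<^sup>2)"
  proof -
    have "(\<Sum>i<N. (u i \<bullet> obs_vec h N z)\<^sup>2) = (u 0 \<bullet> obs_vec h N z)\<^sup>2 + (\<Sum>i\<in>{1..<N}. (u i \<bullet> obs_vec h N z)\<^sup>2)"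
      using N by (simp add: atLeast0LessThan[symmetric] sum.atLeast_Suc_lessThan)
    then show ?thesis using N by (simp add: uz)
  qed
  also have "(\<Sum>i\<in>{1..<N}. (\<alpha> * y i)\<^sup>2) = \<alpha>\<^sup>2 * (\<Sum>i\<in>{1..<N}. (y i)\<^sup>2)"
    by (simp add: power_mult_distrib sum_distrib_left)
  finally have "alpha_sq_hat h m H N z = \<alpha>\<^sup>2 * ((\<Sum>i\<in>{1..<N}. (y i)\<^sup>2) / real N)"
    unfolding alpha_sq_hat_def quad[OF oz] th using s by (simp add: power2_eq_square)
  then have "1 / \<alpha>\<^sup>2 * sqrt (real N / 2) * (alpha_sq_hat h m H N z - \<alpha>\<^sup>2)
      = sqrt (real N / 2) * (((\<Sum>i\<in>{1..<N}. (y i)\<^sup>2) - real N) / real N)"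
    using \<alpha> N by (simp add: field_simps)
  also have "sqrt (real N / 2) * (x / real N) = x / sqrt (2 * real N)" for x
  proof -
    have "sqrt (real N / 2) * sqrt (2 * real N) = real N"
      using N by (simp add: real_sqrt_mult[symmetric])
    moreover have "0 < sqrt (2 * real N)" using N by simp
    ultimately show ?thesis using N by (simp add: field_simps)
  qed
  finally show "1 / \<alpha>\<^sup>2 * sqrt (real N / 2) * (alpha_sq_hat h m H N z - \<alpha>\<^sup>2)
      = ((\<Sum>i\<in>{1..<N}. (y i)\<^sup>2) - real N) / sqrt (2 * real N)" .
qed

theorem theorem4p12:
  fixes M :: "'a measure"
    and h \<theta> \<alpha> :: real
    and m :: nat
    and H :: "nat \<Rightarrow> real"
    and B :: "nat \<Rightarrow> real \<Rightarrow> 'a \<Rightarrow> real"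
    and Z :: "real \<Rightarrow> 'a \<Rightarrow> real"
    and S F :: "nat \<Rightarrow> 'a \<Rightarrow> real"
  assumes "prob_space M"
    and "h > 0" and "m \<ge> 1" and "\<alpha> > 0"
    and "\<And>r. r \<in> {1..m} \<Longrightarrow> 1 / 2 < H r \<and> H r < 1"
    and "\<And>r. r \<in> {1..m} \<Longrightarrow> fractional_brownian_motion M (H r) (B r)"
    and "independent_processes M {1..m} B"
  defines "Z \<equiv> mixed_fbm \<theta> \<alpha> m B"
    and "S \<equiv> \<lambda>N \<omega>. sqrt (d_norm h m H N) * (theta_hat h m H N (\<lambda>t. Z t \<omega>) - \<theta>)"
    and "F \<equiv> \<lambda>N \<omega>. 1 / \<alpha>\<^sup>2 * sqrt (real N / 2) * (alpha_sq_hat h m H N (\<lambda>t. Z t \<omega>) - \<alpha>\<^sup>2)"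
  shows "(\<forall>N\<ge>1. distributed M lborel (S N) (normal_density 0 \<alpha>)) \<and>
    weak_conv_m (\<lambda>N. distr M borel (S N)) (density lborel (normal_density 0 \<alpha>)) \<and>
    weak_conv_m (\<lambda>N. distr M borel (F N)) std_normal_distribution \<and>
    (\<forall>N\<ge>1. prob_space.indep_var M borel (S N) borel (F N)) \<and>
    weak_conv_law (\<lambda>N. distr M borel (\<lambda>\<omega>. (S N \<omega>, F N \<omega>))) (bivariate_normal_law (\<alpha>\<^sup>2) 0 1)"
proof -
  interpret prob_space M by (rule assms(1))
  note h = assms(2) and m = assms(3) and \<alpha> = assms(4) and fbm = assms(6) and indep = assms(7)
  have H: "H r < 1" if "r \<in> {1..m}" for r
    using assms(5)[OF that] by simp
  define W where "W t \<omega> = (\<Sum>r=1..m. B r t \<omega>)" for t \<omega>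
  \<comment> \<open>The properties of the system for one N are packed into a predicate, so that a
    single choice provides the systems for all N.\<close>
  define whitening where "whitening N u \<longleftrightarrow> 0 < d_norm h m H N \<and> (\<forall>i<N. u i \<in> carrier_vec N) \<and>
      (\<forall>i<N. \<forall>j<N. u i \<bullet> (fbm_cov_mat h m H N *\<^sub>v u j) = (if i = j then 1 else 0)) \<and>
      (\<forall>i<N. u i \<bullet> time_vec h N = (if i = 0 then sqrt (d_norm h m H N) else 0)) \<and>
      (\<forall>x\<in>carrier_vec N. x \<bullet> (fbm_cov_inv h m H N *\<^sub>v x) = (\<Sum>i<N. (u i \<bullet> x)\<^sup>2)) \<and>
      (\<forall>x\<in>carrier_vec N. time_vec h N \<bullet> (fbm_cov_inv h m H N *\<^sub>v x) = sqrt (d_norm h m H N) * (u 0 \<bullet> x))"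
    for N and u :: "nat \<Rightarrow> real vec"
  have "\<exists>u. whitening N u"
    if N: "1 \<le> N" for N
  proof -
    have pd: "0 < v \<bullet> (fbm_cov_mat h m H N *\<^sub>v v)" if "v \<in> carrier_vec N" "v \<noteq> 0\<^sub>v N" for v
      by (rule fbm_cov_mat_positive_definite[OF H m h fbm that])
    have T: "time_vec h N \<in> carrier_vec N" by (simp add: time_vec_def)
    \<comment> \<open>The first observation time is h, not 0.\<close>
    have "time_vec h N $ 0 \<noteq> 0\<^sub>v N $ 0"
      using N h by (simp add: time_vec_def obs_time_def)
    then have T0: "time_vec h N \<noteq> 0\<^sub>v N" by auto
    show ?thesis
    proof (rule whitening_vectors[OF fbm_cov_mat_carrier fbm_cov_mat_transpose pd T T0,
          folded fbm_cov_inv_def, folded d_norm_def])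
      fix u
      assume "0 < d_norm h m H N" "\<And>i. i < N \<Longrightarrow> u i \<in> carrier_vec N"
        "\<And>i j. i < N \<Longrightarrow> j < N \<Longrightarrow> u i \<bullet> (fbm_cov_mat h m H N *\<^sub>v u j) = (if i = j then 1 else 0)"
        "\<And>i. i < N \<Longrightarrow> u i \<bullet> time_vec h N = (if i = 0 then sqrt (d_norm h m H N) else 0)"
        "\<And>x. x \<in> carrier_vec N \<Longrightarrow> x \<bullet> (fbm_cov_inv h m H N *\<^sub>v x) = (\<Sum>i<N. (u i \<bullet> x)\<^sup>2)"
        "\<And>x. x \<in> carrier_vec N \<Longrightarrow>
          time_vec h N \<bullet> (fbm_cov_inv h m H N *\<^sub>v x) = sqrt (d_norm h m H N) * (u 0 \<bullet> x)"
      then show ?thesis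
        unfolding whitening_def by (intro exI[of _ u] conjI allI impI ballI)
    qed
  qed
  \<comment> \<open>The guard makes the existence statement total in N, as the choice principle
    requires.\<close>
  then have "\<forall>N. \<exists>u. 1 \<le> N \<longrightarrow> whitening N u" by blast
  then obtain u where whitening: "\<And>N. 1 \<le> N \<Longrightarrow> whitening N (u N)"
    using choice[of "\<lambda>N u. 1 \<le> N \<longrightarrow> whitening N u"] by blast
  have u: "\<And>N. 1 \<le> N \<Longrightarrow> 0 < d_norm h m H N"
    "\<And>N i. 1 \<le> N \<Longrightarrow> i < N \<Longrightarrow> u N i \<in> carrier_vec N"
    "\<And>N i j. 1 \<le> N \<Longrightarrow> i < N \<Longrightarrow> j < N \<Longrightarrow>
      u N i \<bullet> (fbm_cov_mat h m H N *\<^sub>v u N j) = (if i = j then 1 else 0)"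
    "\<And>N i. 1 \<le> N \<Longrightarrow> i < N \<Longrightarrow> u N i \<bullet> time_vec h N = (if i = 0 then sqrt (d_norm h m H N) else 0)"
    "\<And>N x. 1 \<le> N \<Longrightarrow> x \<in> carrier_vec N \<Longrightarrow> x \<bullet> (fbm_cov_inv h m H N *\<^sub>v x) = (\<Sum>i<N. (u N i \<bullet> x)\<^sup>2)"
    "\<And>N x. 1 \<le> N \<Longrightarrow> x \<in> carrier_vec N \<Longrightarrow>
      time_vec h N \<bullet> (fbm_cov_inv h m H N *\<^sub>v x) = sqrt (d_norm h m H N) * (u N 0 \<bullet> x)"
    using whitening unfolding whitening_def by simp_all
  define Y where "Y N i \<omega> = (\<Sum>j<N. u N i $ j * W (real (Suc j) * h) \<omega>)" for N i \<omega>
  have iid: "Y N i \<in> borel_measurable M" "indep_vars (\<lambda>_. borel) (Y N) {..<N}"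
    "i < N \<Longrightarrow> distr M borel (Y N i) = std_normal_distribution" if "1 \<le> N" for N i
    using whitened_fbm_iid[OF h fbm indep u(2,3)[OF that]]
    unfolding Y_def[abs_def] W_def by blast+
  show ?thesis
  proof (rule std_normal_array_limits[where Y = Y, OF \<alpha>])
    \<comment> \<open>For N = 0 the sum defining Y is empty, hence a constant function.\<close>
    show "Y N i \<in> borel_measurable M" for N i
      using iid(1)[of N i] by (cases N) (simp_all add: Y_def[abs_def])
    show "distr M borel (Y N i) = std_normal_distribution" if "i < N" for N i
      using that by (intro iid(3)) auto
  next
    fix N :: nat and \<omega> :: 'a
    assume N: "1 \<le> N"
    have z: "Z t \<omega> = \<theta> * t + \<alpha> * W t \<omega>" for t
      by (simp add: Z_def mixed_fbm_def W_def)
    note est = estimators_in_whitened_coordinates[where u = "u N" and z = "\<lambda>t. Z t \<omega>" and w = "\<lambda>t. W t \<omega>",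
        OF N \<alpha> u(1)[OF N] u(2)[OF N] u(4)[OF N] u(5)[OF N] u(6)[OF N] z]
    show "S N \<omega> = \<alpha> * Y N 0 \<omega>"
      using est(1) by (simp add: S_def Y_def)
    show "F N \<omega> = ((\<Sum>i\<in>{1..<N}. (Y N i \<omega>)\<^sup>2) - real N) / sqrt (2 * real N)"
      using est(2) by (simp add: F_def Y_def)
  qed (rule iid(2))
qed

end
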